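(* Let $\sigma\ge\frac54$, $m\in\mathbb N\setminus\{1\}$, $b=2\pi(1-\frac1{2\sigma})$, $\beta=bm$, and consider $N\in2\mathbb N$ with $N_1=\sigma N\in2\mathbb N$ and $2m<N_1$. Then the $C(\mathbb T)$-error constant of the continuous $\cosh$-type window function $\varphi_{\cosh}$ satisfies $$e_\sigma(\varphi_{\cosh})\le\frac{\beta\,b(m,\sigma)}{2m}\Big[\frac{\sqrt\pi}{5\sqrt{2m}}\Big(1-\frac1{2\sigma}\Big)\Big(1-\frac1\sigma\Big)^{-3/4}e^{2\pi m\sqrt{1-1/\sigma}}-1-\gamma(m,\sigma)\Big]^{-1}.$$
   Context: $\mathbb N=\{1,2,\dots\}$, $I_N:=\{-N/2,\dots,N/2-1\}$, $\mathbb T=\mathbb R/\mathbb Z$ and $\|\cdot\|_{C(\mathbb T)}$ is the sup-norm. Fourier transform: $\hat\varphi(v):=\int_{\mathbb R}\varphi(x)e^{-2\pi i vx}\,dx$. For given $m,\sigma,N$ the continuous $\cosh$-type window function is $$\varphi_{\cosh}(x):=\frac1{\cosh\beta-1}\Big(\cosh\big(\beta\sqrt{1-(N_1x/m)^2}\big)-1\Big)\ \text{ for }|x|<\tfrac m{N_1},\qquad\varphi_{\cosh}(x):=0\ \text{ otherwise}.$$ Error constants: $$e_{\sigma,N}(\varphi):=\max_{n\in I_N}\Big\|\sum_{r\in\mathbb Z\setminus\{0\}}\frac{\hat\varphi(n+rN_1)}{\hat\varphi(n)}e^{2\pi i rN_1\,\cdot}\Big\|_{C(\mathbb T)},\qquad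 e_\sigma(\varphi):=\sup_N e_{\sigma,N}(\varphi),$$ where the supremum is over all $N\in2\mathbb N$ with $N_1=\sigma N\in2\mathbb N$ and $2m<N_1$, and for each $N$ the window function with parameters $m$, $\beta$ and $N_1=\sigma N$ is used. Constants: $\gamma(m,\sigma):=\int_0^1e^{-\beta\sqrt{1-t^2}}\,dt$, $E_1(x):=\int_x^\infty\frac1te^{-t}\,dt$ $(x>0)$, and \begin{align*} b(m,\sigma):={}&2\pi m+\frac{10}{\sqrt{2\pi m}}\Big(1-\frac1{2\sigma}\Big)^{-1/2}+\Big(1+\frac1e\Big)\frac1\pi\sqrt[4]{\frac5{2\pi m}}\Big(\frac{4\sigma}{2\sigma-1}+8\Big)\Big(1-\frac1{2\sigma}\Big)^{-1/4}\\ &+\frac{8\sigma}{(2\sigma-1)\pi\beta}e^{-\sqrt{2\pi m-\pi m/\sigma}}+\frac8{\pi\beta}E_1\big(\sqrt{2\pi m-\pi m/\sigma}\big)\\ &+\frac{4\pi m+2}{\beta\pi}\Big(e^{-\sqrt2\beta}+\frac12\Big)e^{-2\pi m+\pi m/\sigma}. \end{align*} *)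

theory Defs
  imports "HOL-Analysis.Analysis"
begin

definition fourier :: "(real \<Rightarrow> real) \<Rightarrow> real \<Rightarrow> complex" where
  "fourier \<phi> v = (LINT x|lborel. of_real (\<phi> x) * exp (- 2 * of_real pi * \<i> * of_real v * of_real x))"

definition index_set :: "nat \<Rightarrow> int set" where
  "index_set N = {- (int N div 2) .. int N div 2 - 1}"

text \<open>Functions on the torus are represented by 1-periodic functions on the reals. The norm takes
  values in the extended reals, so that it is infinite (and not an arbitrary real) on unbounded
  functions.\<close>

definition sup_norm :: "(real \<Rightarrow> complex) \<Rightarrow> ereal" where
  "sup_norm f = (SUP x. ereal (norm (f x)))"

definition error_const_N :: "real \<Rightarrow> nat \<Rightarrow> (real \<Rightarrow> real) \<Rightarrow> ereal" where
  "error_const_N \<sigma> N \<phi> =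
     (let N1 = \<sigma> * real N in
      Max ((\<lambda>n. sup_norm (\<lambda>x. \<Sum>\<^sub>\<infinity>r\<in>UNIV - {0::int}.
              fourier \<phi> (of_int n + of_int r * N1) / fourier \<phi> (of_int n)
              * exp (2 * of_real pi * \<i> * of_int r * of_real N1 * of_real x)))
        ` index_set N))"

definition admissible :: "nat \<Rightarrow> real \<Rightarrow> nat set" where
  "admissible m \<sigma> = {N. N > 0 \<and> even N
      \<and> (\<exists>N1::nat. N1 > 0 \<and> even N1 \<and> real N1 = \<sigma> * real N \<and> 2 * m < N1)}"

text \<open>The window function depends on \<open>N\<close> through \<open>\<sigma> * N\<close>; hence the argument \<open>\<Phi>\<close> is the family
  of windows indexed by \<open>N\<close>. The supremum is \<open>-\<infinity>\<close> if no \<open>N\<close> is admissible (e.g. for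
  irrational \<open>\<sigma>\<close>).\<close>

definition error_const :: "nat \<Rightarrow> real \<Rightarrow> (nat \<Rightarrow> real \<Rightarrow> real) \<Rightarrow> ereal" where
  "error_const m \<sigma> \<Phi> = (SUP N\<in>admissible m \<sigma>. error_const_N \<sigma> N (\<Phi> N))"

definition phi_cosh :: "nat \<Rightarrow> real \<Rightarrow> real \<Rightarrow> real \<Rightarrow> real" where
  "phi_cosh m \<beta> N1 x =
     (if \<bar>x\<bar> < real m / N1
      then 1 / (cosh \<beta> - 1) * (cosh (\<beta> * sqrt (1 - (N1 * x / real m)\<^sup>2)) - 1)
      else 0)"

definition gamma_const :: "real \<Rightarrow> real" where
  "gamma_const \<beta> = (LBINT t:{0..1}. exp (- \<beta> * sqrt (1 - t\<^sup>2)))"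

definition E1 :: "real \<Rightarrow> real" where
  "E1 x = (LBINT t:{x..}. 1 / t * exp (- t))"

definition b_const :: "nat \<Rightarrow> real \<Rightarrow> real \<Rightarrow> real" where
  "b_const m \<sigma> \<beta> =
     2 * pi * real m
     + 10 / sqrt (2 * pi * real m) * (1 - 1 / (2 * \<sigma>)) powr (- 1 / 2)
     + (1 + 1 / exp 1) * (1 / pi) * root 4 (5 / (2 * pi * real m))
         * (4 * \<sigma> / (2 * \<sigma> - 1) + 8) * (1 - 1 / (2 * \<sigma>)) powr (- 1 / 4)
     + 8 * \<sigma> / ((2 * \<sigma> - 1) * pi * \<beta>) * exp (- sqrt (2 * pi * real m - pi * real m / \<sigma>))
     + 8 / (pi * \<beta>) * E1 (sqrt (2 * pi * real m - pi * real m / \<sigma>))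
     + (4 * pi * real m + 2) / (\<beta> * pi) * (exp (- sqrt 2 * \<beta>) + 1 / 2)
         * exp (- 2 * pi * real m + pi * real m / \<sigma>)"

end

theory Submission
  imports Defs
begin

text \<open>
  Put \<open>W = 2 * pi * m\<close>, so that \<open>\<beta> = W * (1 - 1 / (2 * \<sigma>))\<close>. Substituting \<open>x = m * t / N1\<close>, the Fourier
  transform of the window at \<open>v\<close> is a factor independent of \<open>v\<close> times \<open>F w\<close>, where
  \<open>w = 2 * pi * m * v / N1\<close> and \<open>F w\<close> is the integral of
  \<open>(cosh (\<beta> * sqrt (1 - t\<^sup>2)) - 1) * cos (w * t)\<close> over \<open>{-1..1}\<close>. The factor cancels in the error
  constant, which is therefore at most the supremum of the sums of \<open>\<bar>F w\<^sub>r\<bar> / F w\<^sub>0\<close> over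
  \<open>r \<noteq> 0\<close>, with \<open>w\<^sub>r = W * (n / N1 + r)\<close>. Since \<open>\<bar>n\<bar> \<le> N / 2\<close>, the frequency \<open>w\<^sub>0\<close> is less
  than \<open>\<beta>\<close> in absolute value and none of the aliases \<open>w\<^sub>r\<close> is; this is what the choice of \<open>\<beta>\<close>
  achieves.

  Because \<open>cosh z - 1 = sinh z - (1 - exp (- z))\<close>, one has \<open>F = S - R\<close>, where \<open>S\<close> and \<open>R\<close> are the
  cosine integrals of \<open>sinh (\<beta> * sqrt (1 - t\<^sup>2))\<close> and of \<open>1 - exp (- \<beta> * sqrt (1 - t\<^sup>2))\<close>.
  The first is a Bessel function up to an elementary factor, and all that is needed about it is that \<open>S w / \<beta>\<close> depends only on
  \<open>\<beta>\<^sup>2 - w\<^sup>2\<close>: expanding both factors into power series and integrating termwise, the Beta-type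
  moments turn the inner sums into binomial expansions of \<open>(\<beta>\<^sup>2 - w\<^sup>2) ^ n\<close>
  (\<open>weighted_product_integral_sums\<close>). Hence all of \<open>\<beta>\<close> may be moved into the frequency, or all of
  \<open>w\<close> into the exponent:

  \<^item> For \<open>\<bar>w\<bar> < \<beta>\<close> and \<open>x = sqrt (\<beta>\<^sup>2 - w\<^sup>2)\<close>, \<open>S w\<close> is \<open>\<beta>\<close> times the integral of
    \<open>sqrt (1 - t\<^sup>2) * cosh (x * t)\<close>, which is at least \<open>exp x / (sqrt 2 * x powr (3 / 2))\<close> for
    \<open>x \<ge> 5\<close>. As \<open>R\<close> is at most \<open>2\<close>, this bounds \<open>F w\<^sub>0\<close> below by the bracket in the theorem.
  \<^item> For \<open>w \<ge> \<beta>\<close> and \<open>y = sqrt (w\<^sup>2 - \<beta>\<^sup>2)\<close>, \<open>S w\<close> is \<open>\<beta>\<close> times the integral of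
    \<open>sqrt (1 - t\<^sup>2) * cos (y * t)\<close>; the exponential growth of the integrand has cancelled. This is
    at most \<open>pi * \<beta> / 2\<close>, and it decays like \<open>y powr (- 3 / 2)\<close>.

  The decay, and that of \<open>R\<close>, comes from one principle for profiles with a square root singularity at
  the endpoints and monotone slope (\<open>endpoint_profile\<close>). Summing over the aliases, \<open>r = 1\<close> and
  \<open>r = -1\<close> contribute at most \<open>pi * \<beta> + 4 / \<beta>\<close>, all others together at most
  \<open>64 * \<beta> / W powr (3 / 2)\<close>. In \<open>b_const\<close>, after multiplication by \<open>\<beta> / (2 * m)\<close>, the first
  summand is \<open>pi * \<beta>\<close> and the next two absorb the rest (\<open>b_const_ge\<close>).
\<close>

section \<open>Moments of the half circle\<close>

definition moment :: "nat \<Rightarrow> nat \<Rightarrow> real" where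
  "moment j k = integral {-1..1} (\<lambda>t. sqrt (1 - t\<^sup>2) ^ (2 * j + 1) * t ^ (2 * k))"

lemma moment_has_integral:
  "((\<lambda>t. sqrt (1 - t\<^sup>2) ^ (2 * j + 1) * t ^ (2 * k)) has_integral moment j k) {-1..1}"
  unfolding moment_def
  by (intro integrable_integral integrable_continuous_real continuous_intros)

lemma sqrt_one_minus_pos:
  fixes t :: real assumes "t \<in> {-1<..<1}" shows "1 - t\<^sup>2 > 0"
  using assms by (simp add: abs_square_less_1 abs_less_iff)

lemma moment_0_0: "moment 0 0 = pi / 2"
proof -
  let ?P = "\<lambda>t::real. (t * sqrt (1 - t\<^sup>2) + arcsin t) / 2"
  have "((\<lambda>t::real. sqrt (1 - t\<^sup>2)) has_integral (?P 1 - ?P (-1))) {-1..1}"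
  proof (rule fundamental_theorem_of_calculus_interior)
    show "continuous_on {-1..1} ?P" by (intro continuous_intros) auto
    fix t :: real assume t: "t \<in> {-1<..<1}"
    note p = sqrt_one_minus_pos[OF t]
    have "(?P has_real_derivative
        (sqrt (1 - t\<^sup>2) + t * (- t / sqrt (1 - t\<^sup>2)) + 1 / sqrt (1 - t\<^sup>2)) / 2) (at t)"
      using t p by (auto intro!: derivative_eq_intros simp: field_simps)
    moreover have "(sqrt (1 - t\<^sup>2) + t * (- t / sqrt (1 - t\<^sup>2)) + 1 / sqrt (1 - t\<^sup>2)) / 2
       = sqrt (1 - t\<^sup>2)"
    proof -
      have "sqrt (1 - t\<^sup>2) * sqrt (1 - t\<^sup>2) = 1 - t\<^sup>2" using p by simp
      then show ?thesis using p by (simp add: field_simps power2_eq_square)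
    qed
    ultimately show "(?P has_vector_derivative sqrt (1 - t\<^sup>2)) (at t)"
      unfolding has_real_derivative_iff_has_vector_derivative by (simp only:)
  qed simp
  then show ?thesis
    using moment_has_integral[of 0 0] by (auto dest: has_integral_unique)
qed

text \<open>Integrating the derivative of \<open>sqrt (1 - t\<^sup>2) ^ (2 * j + 3) * t ^ (2 * k + 1)\<close>, which
  vanishes at both endpoints. Together with the next lemma, this determines all moments from the area
  of the half disc.\<close>

lemma moment_by_parts:
  "(2 * real k + 1) * moment (Suc j) k = (2 * real j + 3) * moment j (Suc k)"
proof -
  let ?P = "\<lambda>t::real. sqrt (1 - t\<^sup>2) ^ (2 * j + 3) * t ^ (2 * k + 1)"
  let ?d = "\<lambda>t::real. (2 * real k + 1) * (sqrt (1 - t\<^sup>2) ^ (2 * Suc j + 1) * t ^ (2 * k))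
       - (2 * real j + 3) * (sqrt (1 - t\<^sup>2) ^ (2 * j + 1) * t ^ (2 * Suc k))"
  have "(?d has_integral (?P 1 - ?P (-1))) {-1..1}"
  proof (rule fundamental_theorem_of_calculus_interior)
    show "continuous_on {-1..1} ?P" by (intro continuous_intros)
    fix t :: real assume t: "t \<in> {-1<..<1}"
    note p = sqrt_one_minus_pos[OF t]
    define s where "s = sqrt (1 - t\<^sup>2)"
    have s: "s > 0" using p by (simp add: s_def)
    have ds: "((\<lambda>t::real. sqrt (1 - t\<^sup>2)) has_real_derivative (- t / s)) (at t)"
      using p by (auto intro!: derivative_eq_intros simp: s_def field_simps)
    have "(?P has_real_derivative
       (real (2 * j + 3) * s ^ (2 * j + 2) * (- t / s)) * t ^ (2 * k + 1)
         + s ^ (2 * j + 3) * (real (2 * k + 1) * t ^ (2 * k))) (at t)"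
      by (rule derivative_eq_intros ds refl | simp add: s_def)+
    moreover have "(real (2 * j + 3) * s ^ (2 * j + 2) * (- t / s)) * t ^ (2 * k + 1)
         + s ^ (2 * j + 3) * (real (2 * k + 1) * t ^ (2 * k)) = ?d t"
      unfolding s_def[symmetric] using s by (simp add: field_simps power_add power2_eq_square eval_nat_numeral)
    ultimately show "(?P has_vector_derivative ?d t) (at t)"
      by (simp add: has_real_derivative_iff_has_vector_derivative)
  qed simp
  moreover have "(?d has_integral (2 * real k + 1) * moment (Suc j) k
      - (2 * real j + 3) * moment j (Suc k)) {-1..1}"
    by (intro has_integral_diff has_integral_mult_right moment_has_integral)
  ultimately have "(2 * real k + 1) * moment (Suc j) k - (2 * real j + 3) * moment j (Suc k)
      = ?P 1 - ?P (-1)"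
    using has_integral_unique by blast
  then show ?thesis by (simp add: power_0_left)
qed

lemma moment_Suc_split: "moment (Suc j) k = moment j k - moment j (Suc k)"
proof -
  have "((\<lambda>t. sqrt (1 - t\<^sup>2) ^ (2 * j + 1) * t ^ (2 * k)
       - sqrt (1 - t\<^sup>2) ^ (2 * j + 1) * t ^ (2 * Suc k))
     has_integral (moment j k - moment j (Suc k))) {-1..1}"
    by (intro has_integral_diff moment_has_integral)
  then have "((\<lambda>t. sqrt (1 - t\<^sup>2) ^ (2 * Suc j + 1) * t ^ (2 * k))
     has_integral (moment j k - moment j (Suc k))) {-1..1}"
  proof (rule has_integral_eq[rotated])
    fix t :: real assume "t \<in> {-1..1}"
    then have "sqrt (1 - t\<^sup>2) ^ 2 = 1 - t\<^sup>2" by (simp add: abs_square_le_1 abs_le_iff)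
    moreover have "sqrt (1 - t\<^sup>2) ^ (2 * Suc j + 1)
        = sqrt (1 - t\<^sup>2) ^ (2 * j + 1) * sqrt (1 - t\<^sup>2) ^ 2"
      by (simp flip: power_add)
    moreover have "t ^ (2 * Suc k) = t ^ (2 * k) * t\<^sup>2"
      by (simp flip: power_add)
    ultimately show "sqrt (1 - t\<^sup>2) ^ (2 * j + 1) * t ^ (2 * k)
       - sqrt (1 - t\<^sup>2) ^ (2 * j + 1) * t ^ (2 * Suc k)
        = sqrt (1 - t\<^sup>2) ^ (2 * Suc j + 1) * t ^ (2 * k)"
      by (simp only:) (simp only: algebra_simps)
  qed
  then show ?thesis using moment_has_integral has_integral_unique by blast
qed

lemma moment_closed_form:
  "moment j k = pi / 2 * fact (2 * k) * fact (2 * j + 1)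
     / (4 ^ (j + k) * fact k * fact j * fact (j + k + 1))"
proof (induction j arbitrary: k)
  case 0
  show ?case
  proof (induction k)
    case 0
    show ?case using moment_0_0 by simp
  next
    case (Suc k)
    have "moment 0 (Suc k) * (2 * real k + 4) = (2 * real k + 1) * moment 0 k"
      using moment_by_parts[of k 0] moment_Suc_split[of 0 k] by (simp add: algebra_simps)
    then have "moment 0 (Suc k) = (2 * real k + 1) / (2 * real k + 4) * moment 0 k"
      by (simp add: field_simps)
    also have "\<dots> = pi / 2 * fact (2 * Suc k) * fact (2 * 0 + 1)
     / (4 ^ (0 + Suc k) * fact (Suc k) * fact 0 * fact (0 + Suc k + 1))"
      unfolding Suc.IH by (simp add: divide_simps) (simp add: algebra_simps)
    finally show ?case .
  qed
next
  case (Suc j)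
  have "moment (Suc j) k * (2 * real j + 2 * real k + 4) = (2 * real j + 3) * moment j k"
  proof -
    have "moment j (Suc k) = moment j k - moment (Suc j) k"
      using moment_Suc_split[of j k] by simp
    then have "(2 * real k + 1) * moment (Suc j) k = (2 * real j + 3) * (moment j k - moment (Suc j) k)"
      using moment_by_parts[of k j] by simp
    then show ?thesis by (simp add: algebra_simps)
  qed
  then have "moment (Suc j) k = (2 * real j + 3) / (2 * real j + 2 * real k + 4) * moment j k"
    by (simp add: field_simps)
  also have "\<dots> = pi / 2 * fact (2 * k) * fact (2 * Suc j + 1)
     / (4 ^ (Suc j + k) * fact k * fact (Suc j) * fact (Suc j + k + 1))"
    unfolding Suc.IH by (simp add: divide_simps) (simp add: algebra_simps)
  finally show ?case .
qed

section \<open>Reduction of the sinh transform to a half circle transform\<close>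

definition cosc_term :: "real \<Rightarrow> nat \<Rightarrow> real" where
  "cosc_term z k = z ^ k / fact (2 * k)"

definition sinhc_term :: "real \<Rightarrow> nat \<Rightarrow> real" where
  "sinhc_term z j = z ^ j / fact (2 * j + 1)"

lemma cosh_even_series: "cosc_term (x\<^sup>2) sums cosh x"
proof -
  have "(\<lambda>n. (if even (2 * n) then x ^ (2 * n) /\<^sub>R fact (2 * n) else 0)) sums cosh x"
    using sums_mono_reindex[of "\<lambda>n. 2 * n" "\<lambda>n. if even n then x ^ n /\<^sub>R fact n else 0" "cosh x"]
      cosh_converges[of x]
    by (force simp: strict_mono_def elim: evenE)
  then show ?thesis
    by (simp add: cosc_term_def[abs_def] power_mult[symmetric] divide_inverse mult.commute)
qed

lemma cos_even_series: "cosc_term (- (x\<^sup>2)) sums cos x"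
proof -
  have "(- (x\<^sup>2)) ^ n = (- 1) ^ n * x ^ (2 * n)" for n
    by (subst power_minus) (simp add: power_mult)
  then show ?thesis
    using cos_paired[of x] by (simp add: cosc_term_def[abs_def])
qed

lemma sinh_odd_series: "(\<lambda>j. x * sinhc_term (x\<^sup>2) j) sums sinh x"
proof -
  have "(\<lambda>n. (if even (2 * n + 1) then 0 else x ^ (2 * n + 1) /\<^sub>R fact (2 * n + 1))) sums sinh x"
    using sums_mono_reindex[of "\<lambda>n. 2 * n + 1" "\<lambda>n. if even n then 0 else x ^ n /\<^sub>R fact n" "sinh x"]
      sinh_converges[of x]
    by (force simp: strict_mono_def elim: oddE)
  then show ?thesis
    by (simp add: sinhc_term_def power_mult[symmetric] divide_inverse mult.commute mult.left_commute)
qed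

lemma abs_summable_cosc_term: "summable (\<lambda>k. norm (cosc_term z k))"
proof -
  have "norm (cosc_term z k) = cosc_term ((sqrt \<bar>z\<bar>)\<^sup>2) k" for k
    by (simp add: cosc_term_def power_abs)
  then show ?thesis using cosh_even_series[of "sqrt \<bar>z\<bar>"] by (simp add: sums_iff)
qed

lemma abs_summable_sinhc_term: "summable (\<lambda>j. norm (sinhc_term z j))"
proof (rule summable_comparison_test'[OF abs_summable_cosc_term])
  fix j :: nat assume "j \<ge> 0"
  have "(fact (2 * j) :: real) \<le> fact (2 * j + 1)" by (rule fact_mono) simp
  then show "norm (norm (sinhc_term z j)) \<le> norm (cosc_term z j)"
    by (simp add: sinhc_term_def cosc_term_def frac_le)
qed

text \<open>The two infinite sums are \<open>sinh z / z\<close> at \<open>z = sqrt (A * (1 - t\<^sup>2))\<close> and \<open>cosh\<close> at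
  \<open>sqrt (B * t\<^sup>2)\<close>, written as power series in the squares so that \<open>A\<close> and \<open>B\<close> may have either
  sign. In the degree \<open>n\<close> part of their product, the moments cancel the factorials of odd and even
  order and leave binomial coefficients. So the integral depends on \<open>A + B\<close> only; it is \<open>pi / 2\<close>
  times a power series for \<open>I\<^sub>1 z / (z / 2)\<close> at \<open>z = sqrt (A + B)\<close>, where \<open>I\<^sub>1\<close> is the modified
  Bessel function.\<close>

lemma weighted_product_integral_sums:
  fixes A B :: real and f :: "real \<Rightarrow> real"
  assumes f: "\<And>t. t \<in> {-1..1} \<Longrightarrow>
     f t = sqrt (1 - t\<^sup>2) * ((\<Sum>j. sinhc_term (A * (1 - t\<^sup>2)) j) * (\<Sum>k. cosc_term (B * t\<^sup>2) k))"
  shows "(\<lambda>n. pi / 2 * (A + B) ^ n / (4 ^ n * fact n * fact (n + 1))) sums integral {-1..1} f"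
proof -
  let ?T = "\<lambda>n t. \<Sum>j\<le>n. A ^ j / fact (2 * j + 1) * (B ^ (n - j) / fact (2 * (n - j)))
      * (sqrt (1 - t\<^sup>2) ^ (2 * j + 1) * t ^ (2 * (n - j)))"
  \<comment> \<open>\<open>?T n\<close> is the part of degree \<open>n\<close> in \<open>A\<close> and \<open>B\<close>, and \<open>?M n\<close> is a bound for it that does not
    depend on \<open>t\<close> and justifies termwise integration\<close>
  let ?M = "\<lambda>n. \<Sum>j\<le>n. norm (sinhc_term A j) * norm (cosc_term B (n - j))"
  have T_sums: "(\<lambda>n. ?T n t) sums f t" if t: "t \<in> {-1..1}" for t
  proof -
    define s where "s = sqrt (1 - t\<^sup>2)"
    have s0: "\<bar>s\<bar> = s" using t by (simp add: s_def abs_square_le_1 abs_le_iff)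
    have s2: "1 - t\<^sup>2 = s\<^sup>2" unfolding s_def
      using t by (simp add: abs_square_le_1 abs_le_iff)
    have "(\<lambda>n. \<Sum>j\<le>n. sinhc_term (A * (1 - t\<^sup>2)) j * cosc_term (B * t\<^sup>2) (n - j)) sums
       ((\<Sum>j. sinhc_term (A * (1 - t\<^sup>2)) j) * (\<Sum>k. cosc_term (B * t\<^sup>2) k))"
      by (intro Cauchy_product_sums abs_summable_sinhc_term abs_summable_cosc_term)
    then have "(\<lambda>n. sqrt (1 - t\<^sup>2) *
       (\<Sum>j\<le>n. sinhc_term (A * (1 - t\<^sup>2)) j * cosc_term (B * t\<^sup>2) (n - j))) sums f t"
      unfolding f[OF t] by (rule sums_mult)
    moreover have "sqrt (1 - t\<^sup>2) *
       (\<Sum>j\<le>n. sinhc_term (A * (1 - t\<^sup>2)) j * cosc_term (B * t\<^sup>2) (n - j)) = ?T n t" for n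
      unfolding s_def[symmetric] s2 sum_distrib_left
      by (rule sum.cong)
        (simp_all add: sinhc_term_def cosc_term_def power_mult_distrib s0 flip: power_mult)
    ultimately show ?thesis by simp
  qed
  have bound: "norm (?T n t) \<le> ?M n" if t: "t \<in> {-1..1}" for n t
  proof -
    have "\<bar>sqrt (1 - t\<^sup>2)\<bar> \<le> 1" "\<bar>t\<bar> \<le> 1"
      using t by (auto simp: abs_square_le_1 abs_le_iff)
    then have "\<bar>sqrt (1 - t\<^sup>2) ^ i * t ^ l\<bar> \<le> 1" for i l
      unfolding abs_mult power_abs by (intro mult_le_one power_le_one) auto
    then have "norm (A ^ j / fact (2 * j + 1) * (B ^ (n - j) / fact (2 * (n - j)))
      * (sqrt (1 - t\<^sup>2) ^ (2 * j + 1) * t ^ (2 * (n - j))))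
       \<le> norm (sinhc_term A j) * norm (cosc_term B (n - j)) * 1" for j
      unfolding norm_mult[symmetric] sinhc_term_def cosc_term_def
      by (subst norm_mult, intro mult_left_mono) (simp_all only: real_norm_def norm_ge_zero abs_ge_zero)
    then show ?thesis by (intro sum_norm_le) simp
  qed
  have "summable ?M"
    using summable_Cauchy_product[of "\<lambda>j. norm (sinhc_term A j)" "\<lambda>k. norm (cosc_term B k)"]
      abs_summable_sinhc_term abs_summable_cosc_term by simp
  then have "uniform_limit {-1..1} (\<lambda>m t. \<Sum>n<m. ?T n t) (\<lambda>t. \<Sum>n. ?T n t) sequentially"
    by (rule Weierstrass_m_test[rotated]) (rule bound)
  then have ul: "uniform_limit {-1..1} (\<lambda>m t. \<Sum>n<m. ?T n t) f sequentially"
    by (rule uniform_limit_cong'[THEN iffD1, rotated 2]) (rule refl, rule T_sums[THEN sums_unique, symmetric])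
  obtain I J where I: "\<And>m. ((\<lambda>t. \<Sum>n<m. ?T n t) has_integral I m) {-1..1}"
    and J: "(f has_integral J) {-1..1}" and IJ: "I \<longlonglongrightarrow> J"
    by (rule uniform_limit_integral[OF ul]) (auto intro!: continuous_intros)
  have T_int: "(?T n has_integral (pi / 2 * (A + B) ^ n / (4 ^ n * fact n * fact (n + 1)))) {-1..1}" for n
  proof -
    have "(?T n has_integral (\<Sum>j\<le>n. A ^ j / fact (2 * j + 1) * (B ^ (n - j) / fact (2 * (n - j)))
       * moment j (n - j))) {-1..1}"
      by (intro has_integral_sum has_integral_mult_right moment_has_integral) simp
    also have "(\<Sum>j\<le>n. A ^ j / fact (2 * j + 1) * (B ^ (n - j) / fact (2 * (n - j))) * moment j (n - j))
       = (\<Sum>j\<le>n. pi / 2 / (4 ^ n * fact n * fact (n + 1)) * (of_nat (n choose j) * A ^ j * B ^ (n - j)))"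
      by (rule sum.cong) (simp_all add: moment_closed_form binomial_fact divide_simps)
    also have "\<dots> = pi / 2 * (A + B) ^ n / (4 ^ n * fact n * fact (n + 1))"
      unfolding sum_distrib_left[symmetric] binomial_ring[of A B n] by simp
    finally show ?thesis .
  qed
  have "I = (\<lambda>m. \<Sum>n<m. pi / 2 * (A + B) ^ n / (4 ^ n * fact n * fact (n + 1)))"
    by (rule ext, rule has_integral_unique[OF I has_integral_sum[OF _ T_int]]) simp
  then have "(\<lambda>n. pi / 2 * (A + B) ^ n / (4 ^ n * fact n * fact (n + 1))) sums J"
    unfolding sums_def using IJ by (simp only:)
  then show ?thesis using J by (simp add: integral_unique)
qed

lemma sinh_cos_integral_sums:
  "(\<lambda>n. \<beta> * (pi / 2 * (\<beta>\<^sup>2 - w\<^sup>2) ^ n / (4 ^ n * fact n * fact (n + 1)))) sums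
     integral {-1..1} (\<lambda>t. sinh (\<beta> * sqrt (1 - t\<^sup>2)) * cos (w * t))"
proof -
  let ?f = "\<lambda>t::real. sqrt (1 - t\<^sup>2) *
     ((\<Sum>j. sinhc_term (\<beta>\<^sup>2 * (1 - t\<^sup>2)) j) * (\<Sum>k. cosc_term (- (w\<^sup>2) * t\<^sup>2) k))"
  have "\<beta> * ?f t = sinh (\<beta> * sqrt (1 - t\<^sup>2)) * cos (w * t)" if t: "t \<in> {-1..1}" for t
  proof -
    have sq: "(\<beta> * sqrt (1 - t\<^sup>2))\<^sup>2 = \<beta>\<^sup>2 * (1 - t\<^sup>2)"
      using t by (simp add: power_mult_distrib abs_square_le_1 abs_le_iff)
    have "sinh (\<beta> * sqrt (1 - t\<^sup>2)) = \<beta> * sqrt (1 - t\<^sup>2) * (\<Sum>j. sinhc_term (\<beta>\<^sup>2 * (1 - t\<^sup>2)) j)"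
      using sums_unique[OF sinh_odd_series[of "\<beta> * sqrt (1 - t\<^sup>2)"]]
        suminf_mult[OF summable_norm_cancel[OF abs_summable_sinhc_term]]
      unfolding sq by simp
    moreover have "cos (w * t) = (\<Sum>k. cosc_term (- (w\<^sup>2) * t\<^sup>2) k)"
      using sums_unique[OF cos_even_series[of "w * t"]] by (simp add: power_mult_distrib)
    ultimately show ?thesis by simp
  qed
  then have "integral {-1..1} (\<lambda>t. sinh (\<beta> * sqrt (1 - t\<^sup>2)) * cos (w * t))
      = integral {-1..1} (\<lambda>t. \<beta> * ?f t)"
    by (intro integral_cong) simp
  also have "\<dots> = \<beta> * integral {-1..1} ?f" by simp
  finally show ?thesis
    using sums_mult[OF weighted_product_integral_sums[of ?f "\<beta>\<^sup>2" "- (w\<^sup>2)"], of \<beta>] by simp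
qed

lemma sinhc_term_0_suminf: "(\<Sum>j. sinhc_term 0 j) = 1"
  by (subst suminf_finite[of "{0}"]) (auto simp: sinhc_term_def)

text \<open>The pairs \<open>(\<beta>\<^sup>2, - w\<^sup>2)\<close> and \<open>(0, - y\<^sup>2)\<close> have the same sum.\<close>

lemma sinh_cos_integral_above:
  assumes "w\<^sup>2 = \<beta>\<^sup>2 + y\<^sup>2"
  shows "integral {-1..1} (\<lambda>t. sinh (\<beta> * sqrt (1 - t\<^sup>2)) * cos (w * t))
    = \<beta> * integral {-1..1} (\<lambda>t. sqrt (1 - t\<^sup>2) * cos (y * t))"
proof -
  let ?I = "integral {-1..1} (\<lambda>t. sqrt (1 - t\<^sup>2) * cos (y * t))"
  have "cos (y * t) = (\<Sum>k. cosc_term (- (y\<^sup>2) * t\<^sup>2) k)" for t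
    using sums_unique[OF cos_even_series[of "y * t"]] by (simp add: power_mult_distrib)
  then have "(\<lambda>n. pi / 2 * (0 + - (y\<^sup>2)) ^ n / (4 ^ n * fact n * fact (n + 1))) sums ?I"
    by (intro weighted_product_integral_sums) (simp add: sinhc_term_0_suminf)
  from sums_mult[OF this, of \<beta>] show ?thesis
    using sinh_cos_integral_sums[of \<beta> w] assms by (simp add: sums_unique2)
qed

text \<open>The pairs \<open>(\<beta>\<^sup>2, - w\<^sup>2)\<close> and \<open>(0, x\<^sup>2)\<close> have the same sum.\<close>

lemma sinh_cos_integral_below:
  assumes "\<beta>\<^sup>2 = w\<^sup>2 + x\<^sup>2"
  shows "integral {-1..1} (\<lambda>t. sinh (\<beta> * sqrt (1 - t\<^sup>2)) * cos (w * t))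
    = \<beta> * integral {-1..1} (\<lambda>t. sqrt (1 - t\<^sup>2) * cosh (x * t))"
proof -
  let ?I = "integral {-1..1} (\<lambda>t. sqrt (1 - t\<^sup>2) * cosh (x * t))"
  have "cosh (x * t) = (\<Sum>k. cosc_term (x\<^sup>2 * t\<^sup>2) k)" for t
    using sums_unique[OF cosh_even_series[of "x * t"]] by (simp add: power_mult_distrib)
  then have "(\<lambda>n. pi / 2 * (0 + x\<^sup>2) ^ n / (4 ^ n * fact n * fact (n + 1))) sums ?I"
    by (intro weighted_product_integral_sums) (simp add: sinhc_term_0_suminf)
  from sums_mult[OF this, of \<beta>] show ?thesis
    using sinh_cos_integral_sums[of \<beta> w] assms by (simp add: sums_unique2)
qed

section \<open>Decay of cosine transforms with square root endpoints\<close>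

lemma abs_integral_sin_le:
  fixes w :: real
  assumes "w > 0" "a \<le> b"
  shows "\<bar>integral {a..b} (\<lambda>t. sin (w * t))\<bar> \<le> 2 / w"
proof -
  have "((\<lambda>t. sin (w * t)) has_integral (- cos (w * b) / w - (- cos (w * a) / w))) {a..b}"
    using assms
    by (intro fundamental_theorem_of_calculus)
      (auto intro!: derivative_eq_intros simp flip: has_real_derivative_iff_has_vector_derivative)
  then have "integral {a..b} (\<lambda>t. sin (w * t)) = (cos (w * a) - cos (w * b)) / w"
    by (simp add: integral_unique diff_divide_distrib)
  moreover have "\<bar>cos (w * a) - cos (w * b)\<bar> \<le> 2"
    using cos_le_one[of "w * a"] cos_le_one[of "w * b"] cos_ge_minus_one[of "w * a"]
      cos_ge_minus_one[of "w * b"] by linarith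
  ultimately show ?thesis using assms by (simp add: divide_right_mono)
qed

text \<open>A profile \<open>h\<close> on \<open>{0..1}\<close> that decreases to \<open>0\<close> with a slope \<open>- q\<close> that may blow up like an
  inverse square root at \<open>1\<close>; monotonicity of \<open>q\<close> means that \<open>h\<close> is concave. The value of \<open>q\<close> at the
  singular point is fixed to \<open>0\<close>, as division by zero yields in both instances below.\<close>

locale endpoint_profile =
  fixes h q :: "real \<Rightarrow> real" and L :: real
  assumes cont: "continuous_on {0..1} h"
    and h1: "h 1 = 0"
    and deriv: "\<And>t. t \<in> {0<..<1} \<Longrightarrow> (h has_real_derivative - q t) (at t)"
    and q0: "q 0 = 0"
    and q1: "q 1 = 0"
    and mono: "\<And>s t. 0 \<le> s \<Longrightarrow> s \<le> t \<Longrightarrow> t < 1 \<Longrightarrow> q s \<le> q t"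
    and q_le: "\<And>t. t \<in> {0..<1} \<Longrightarrow> q t \<le> L / sqrt (2 * (1 - t))"
    and h_le: "\<And>t. t \<in> {0..1} \<Longrightarrow> h t \<le> L * sqrt (2 * (1 - t))"
begin

lemma q_nonneg: "t \<in> {0..1} \<Longrightarrow> q t \<ge> 0"
  using mono[of 0 t] q0 q1 by (cases "t = 1") auto

lemma q_has_integral:
  assumes "0 \<le> a" "a \<le> 1" shows "(q has_integral h a) {a..1}"
proof -
  have "((\<lambda>t. - q t) has_integral (h 1 - h a)) {a..1}"
    using assms
    by (intro fundamental_theorem_of_calculus_interior continuous_on_subset[OF cont])
      (auto simp: deriv simp flip: has_real_derivative_iff_has_vector_derivative)
  from has_integral_neg[OF this] show ?thesis using h1 by simp
qed

lemma by_parts: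
  assumes "w > 0"
  shows "((\<lambda>t. q t * sin (w * t)) has_integral (w * integral {0..1} (\<lambda>t. h t * cos (w * t)))) {0..1}"
proof -
  have "((\<lambda>t. h t * (w * cos (w * t)) - q t * sin (w * t)) has_integral
      (h 1 * sin (w * 1) - h 0 * sin (w * 0))) {0..1}"
  proof (rule fundamental_theorem_of_calculus_interior)
    show "continuous_on {0..1} (\<lambda>t. h t * sin (w * t))"
      by (intro continuous_intros cont)
    fix t :: real assume "t \<in> {0<..<1}"
    then show "((\<lambda>t. h t * sin (w * t)) has_vector_derivative
        h t * (w * cos (w * t)) - q t * sin (w * t)) (at t)"
      unfolding has_real_derivative_iff_has_vector_derivative[symmetric]
      by (auto intro!: derivative_eq_intros deriv)
  qed simp
  moreover have "((\<lambda>t. w * (h t * cos (w * t))) has_integral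
      w * integral {0..1} (\<lambda>t. h t * cos (w * t))) {0..1}"
    by (intro has_integral_mult_right integrable_integral integrable_continuous_real
        continuous_intros cont)
  ultimately have "((\<lambda>t. w * (h t * cos (w * t)) - (h t * (w * cos (w * t)) - q t * sin (w * t)))
     has_integral (w * integral {0..1} (\<lambda>t. h t * cos (w * t)) - 
       (h 1 * sin (w * 1) - h 0 * sin (w * 0)))) {0..1}"
    by (rule has_integral_diff[rotated])
  then show ?thesis using h1 by (simp add: algebra_simps)
qed

lemma tail_bound:
  assumes "w > 0" "0 \<le> a" "a \<le> 1"
  shows "\<bar>integral {a..1} (\<lambda>t. q t * sin (w * t))\<bar> \<le> h a"
proof -
  have "(\<lambda>t. q t * sin (w * t)) integrable_on {0..1}"
    using by_parts[OF assms(1)] by (rule has_integral_integrable)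
  then have int: "(\<lambda>t. q t * sin (w * t)) integrable_on {a..1}"
    by (rule integrable_on_subinterval) (use assms in auto)
  have q': "q integrable_on {a..1}" "integral {a..1} q = h a"
    using q_has_integral[OF assms(2,3)] by (auto simp: has_integral_iff)
  show ?thesis
    unfolding q'(2)[symmetric] real_norm_def[symmetric]
  proof (rule integral_norm_bound_integral[OF int q'(1)])
    fix t assume "t \<in> {a..1}"
    then have "q t \<ge> 0" using assms by (intro q_nonneg) auto
    then show "norm (q t * sin (w * t)) \<le> q t"
      by (simp add: abs_mult mult_left_le)
  qed
qed

lemma cos_integral_le_inverse:
  assumes "w > 0"
  shows "\<bar>integral {0..1} (\<lambda>t. h t * cos (w * t))\<bar> \<le> h 0 / w"
proof -
  have "\<bar>w * integral {0..1} (\<lambda>t. h t * cos (w * t))\<bar> \<le> h 0"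
    using tail_bound[of w 0] by_parts[OF assms] assms by (simp add: integral_unique)
  then show ?thesis using assms by (simp add: abs_mult field_simps)
qed

text \<open>After the integration by parts, split at distance \<open>1 / w\<close> from the singular endpoint. To the
  left, the second mean value theorem pulls out the largest slope, which leaves an integral of a sine
  of size \<open>2 / w\<close>; to the right, the total variation of \<open>h\<close> is already small.\<close>

lemma cos_integral_le:
  assumes "w \<ge> 1"
  shows "\<bar>integral {0..1} (\<lambda>t. h t * cos (w * t))\<bar> \<le> 2 * sqrt 2 * L / (w * sqrt w)"
proof -
  have w: "w > 0" using assms by simp
  let ?g = "\<lambda>t. q t * sin (w * t)"
  define a where "a = 1 - 1 / w"
  have a: "0 \<le> a" "a < 1" using assms by (auto simp: a_def)
  obtain c where c: "c \<in> {0..a}"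
    and "(?g has_integral (q 0 * integral {0..c} (\<lambda>t. sin (w * t))
       + q a * integral {c..a} (\<lambda>t. sin (w * t)))) {0..a}"
  proof (rule second_mean_value_theorem_full[of "\<lambda>t. sin (w * t)" 0 a q])
    show "(\<lambda>t. sin (w * t)) integrable_on {0..a}"
      by (intro integrable_continuous_real continuous_intros)
    show "q x \<le> q y" if "0 \<le> x" "x \<le> y" "y \<le> a" for x y
      using mono that a by simp
  qed (use a in simp)
  then have left: "(?g has_integral (q a * integral {c..a} (\<lambda>t. sin (w * t)))) {0..a}"
    using q0 by simp
  have "?g integrable_on {0..1}"
    using by_parts[OF w] by (rule has_integral_integrable)
  then have "?g integrable_on {a..1}"
    by (rule integrable_on_subinterval) (use a in auto)
  then have right: "(?g has_integral integral {a..1} ?g) {a..1}"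
    by (rule integrable_integral)
  have "(?g has_integral (q a * integral {c..a} (\<lambda>t. sin (w * t)) + integral {a..1} ?g)) {0..1}"
    by (rule has_integral_combine[OF _ _ left right]) (use a in auto)
  then have eq: "w * integral {0..1} (\<lambda>t. h t * cos (w * t))
      = q a * integral {c..a} (\<lambda>t. sin (w * t)) + integral {a..1} ?g"
    using by_parts[OF w] has_integral_unique by blast
  have "\<bar>q a * integral {c..a} (\<lambda>t. sin (w * t))\<bar> \<le> L / sqrt (2 * (1 - a)) * (2 / w)"
    unfolding abs_mult using q_nonneg[of a] q_le[of a] a abs_integral_sin_le[OF w, of c a] c
    by (intro mult_mono) auto
  moreover have "\<bar>integral {a..1} ?g\<bar> \<le> L * sqrt (2 * (1 - a))"
    using tail_bound[OF w, of a] h_le[of a] a by simp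
  moreover have root: "sqrt (2 * (1 - a)) = sqrt 2 / sqrt w"
    by (simp add: a_def real_sqrt_divide)
  moreover have "L / (sqrt 2 / sqrt w) * (2 / w) = sqrt 2 * L / sqrt w"
  proof -
    have "L / (v / u) * ((v * v) / (u * u)) = v * L / u" if "v > 0" "u > 0" for u v :: real
      using that by simp
    from this[of "sqrt 2" "sqrt w"] show ?thesis using w by simp
  qed
  moreover have "L * (sqrt 2 / sqrt w) = sqrt 2 * L / sqrt w" by simp
  ultimately have "\<bar>w * integral {0..1} (\<lambda>t. h t * cos (w * t))\<bar> \<le> 2 * sqrt 2 * L / sqrt w"
    unfolding eq root by linarith
  then show ?thesis using w by (simp add: abs_mult field_simps)
qed

end

lemma integral_even_function:
  fixes f :: "real \<Rightarrow> real"
  assumes "continuous_on {-1..1} f" "\<And>t. f (- t) = f t"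
  shows "integral {-1..1} f = 2 * integral {0..1} f"
proof -
  have "f integrable_on {-1..1}" by (intro integrable_continuous_real assms)
  then have "integral {-1..0} f + integral {0..1} f = integral {-1..1} f"
    by (intro Henstock_Kurzweil_Integration.integral_combine) auto
  moreover have "integral {-1..0} f = integral {0..1} f"
    using Henstock_Kurzweil_Integration.integral_reflect_real[of 1 0 f] assms(2) by simp
  ultimately show ?thesis by simp
qed

lemma sqrt_one_minus_square_le:
  assumes "t \<in> {0..1::real}" shows "sqrt (1 - t\<^sup>2) \<le> sqrt (2 * (1 - t))"
proof -
  have "(1 - t\<^sup>2) = (1 - t) * (1 + t)" by (simp add: power2_eq_square algebra_simps)
  also have "\<dots> \<le> (1 - t) * 2" using assms by (intro mult_left_mono) auto
  finally show ?thesis by simp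
qed

lemma slope_le:
  assumes "t \<in> {0..<1::real}" shows "t / sqrt (1 - t\<^sup>2) \<le> 1 / sqrt (2 * (1 - t))"
proof -
  have p: "1 - t\<^sup>2 > 0" using assms by (intro sqrt_one_minus_pos) auto
  have "t * t * (2 * (1 - t)) \<le> 1 - t\<^sup>2"
  proof -
    have "1 - t\<^sup>2 - t * t * (2 * (1 - t)) = (1 - t)\<^sup>2 * (1 + 2 * t)"
      by (simp add: power2_eq_square algebra_simps)
    moreover have "\<dots> \<ge> 0" using assms by simp
    ultimately show ?thesis by simp
  qed
  then have "sqrt (t * t * (2 * (1 - t))) \<le> sqrt (1 - t\<^sup>2)" by simp
  then have "t * sqrt (2 * (1 - t)) \<le> sqrt (1 - t\<^sup>2)"
    using assms by (simp add: real_sqrt_mult)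
  then show ?thesis using p assms by (simp add: field_simps)
qed

lemma slope_mono:
  assumes "0 \<le> s" "s \<le> t" "t < (1::real)"
  shows "s / sqrt (1 - s\<^sup>2) \<le> t / sqrt (1 - t\<^sup>2)"
proof -
  have "1 - t\<^sup>2 > 0" using assms by (intro sqrt_one_minus_pos) auto
  moreover have "s\<^sup>2 \<le> t\<^sup>2" using assms by (intro power_mono)
  ultimately show ?thesis using assms by (intro frac_le) auto
qed

lemma deriv_circle:
  assumes "t \<in> {-1<..<1::real}"
  shows "((\<lambda>t. sqrt (1 - t\<^sup>2)) has_real_derivative - (t / sqrt (1 - t\<^sup>2))) (at t)"
  using sqrt_one_minus_pos[OF assms] by (auto intro!: derivative_eq_intros simp: field_simps)

interpretation circle: endpoint_profile "\<lambda>t. sqrt (1 - t\<^sup>2)" "\<lambda>t. t / sqrt (1 - t\<^sup>2)" 1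
proof
  show "continuous_on {0..1} (\<lambda>t::real. sqrt (1 - t\<^sup>2))" by (intro continuous_intros)
  show "t / sqrt (1 - t\<^sup>2) \<le> 1 / sqrt (2 * (1 - t))" if "t \<in> {0..<1}" for t :: real
    using that by (rule slope_le)
  show "sqrt (1 - t\<^sup>2) \<le> 1 * sqrt (2 * (1 - t))" if "t \<in> {0..1}" for t :: real
    using sqrt_one_minus_square_le[OF that] by simp
qed (auto simp: deriv_circle slope_mono)

lemma circle_cos_integral_le:
  assumes "y \<ge> 1"
  shows "\<bar>integral {-1..1} (\<lambda>t. sqrt (1 - t\<^sup>2) * cos (y * t))\<bar> \<le> 4 * sqrt 2 / (y * sqrt y)"
proof -
  have "integral {-1..1} (\<lambda>t. sqrt (1 - t\<^sup>2) * cos (y * t))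
      = 2 * integral {0..1} (\<lambda>t. sqrt (1 - t\<^sup>2) * cos (y * t))"
    by (rule integral_even_function) (auto intro!: continuous_intros)
  then show ?thesis using circle.cos_integral_le[OF assms] by simp
qed

lemma one_minus_exp_profile:
  assumes "\<beta> > 0"
  shows "endpoint_profile (\<lambda>t. 1 - exp (- \<beta> * sqrt (1 - t\<^sup>2)))
     (\<lambda>t. \<beta> * exp (- \<beta> * sqrt (1 - t\<^sup>2)) * (t / sqrt (1 - t\<^sup>2))) \<beta>"
proof
  show "continuous_on {0..1} (\<lambda>t. 1 - exp (- \<beta> * sqrt (1 - t\<^sup>2)))" by (intro continuous_intros)
next
  fix t :: real assume "t \<in> {0<..<1}"
  then have t: "t \<in> {-1<..<1}" by auto
  show "((\<lambda>t. 1 - exp (- \<beta> * sqrt (1 - t\<^sup>2))) has_real_derivative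
     - (\<beta> * exp (- \<beta> * sqrt (1 - t\<^sup>2)) * (t / sqrt (1 - t\<^sup>2)))) (at t)"
    by (rule derivative_eq_intros deriv_circle[OF t] refl | simp)+
next
  fix s t :: real assume st: "0 \<le> s" "s \<le> t" "t < 1"
  have "1 - t\<^sup>2 > 0" using st by (intro sqrt_one_minus_pos) auto
  then have "s / sqrt (1 - s\<^sup>2) \<ge> 0" "t / sqrt (1 - t\<^sup>2) \<ge> 0" "s\<^sup>2 \<le> t\<^sup>2"
    using st by (auto intro!: divide_nonneg_nonneg power_mono simp: abs_square_le_1)
  then show "\<beta> * exp (- \<beta> * sqrt (1 - s\<^sup>2)) * (s / sqrt (1 - s\<^sup>2))
      \<le> \<beta> * exp (- \<beta> * sqrt (1 - t\<^sup>2)) * (t / sqrt (1 - t\<^sup>2))"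
    using assms slope_mono[OF st] by (intro mult_mono) auto
next
  fix t :: real assume t: "t \<in> {0..<1}"
  have "1 - t\<^sup>2 > 0" using t by (intro sqrt_one_minus_pos) auto
  then have "\<beta> * exp (- \<beta> * sqrt (1 - t\<^sup>2)) * (t / sqrt (1 - t\<^sup>2))
      \<le> \<beta> * 1 * (1 / sqrt (2 * (1 - t)))"
    using assms t slope_le[OF t] by (intro mult_mono) auto
  then show "\<beta> * exp (- \<beta> * sqrt (1 - t\<^sup>2)) * (t / sqrt (1 - t\<^sup>2)) \<le> \<beta> / sqrt (2 * (1 - t))"
    by simp
next
  fix t :: real assume t: "t \<in> {0..1}"
  have "1 - exp (- \<beta> * sqrt (1 - t\<^sup>2)) \<le> \<beta> * sqrt (1 - t\<^sup>2)"
    using exp_ge_add_one_self[of "- \<beta> * sqrt (1 - t\<^sup>2)"] by simp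
  also have "\<dots> \<le> \<beta> * sqrt (2 * (1 - t))"
    using assms sqrt_one_minus_square_le[OF t] by (intro mult_left_mono) auto
  finally show "1 - exp (- \<beta> * sqrt (1 - t\<^sup>2)) \<le> \<beta> * sqrt (2 * (1 - t))" .
qed auto

lemma one_minus_exp_cos_integral_le:
  assumes "\<beta> > 0"
  shows "w > 0 \<Longrightarrow> \<bar>integral {-1..1} (\<lambda>t. (1 - exp (- \<beta> * sqrt (1 - t\<^sup>2))) * cos (w * t))\<bar> \<le> 2 / w"
    and "w \<ge> 1 \<Longrightarrow> \<bar>integral {-1..1} (\<lambda>t. (1 - exp (- \<beta> * sqrt (1 - t\<^sup>2))) * cos (w * t))\<bar>
      \<le> 4 * sqrt 2 * \<beta> / (w * sqrt w)"
proof -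
  interpret endpoint_profile "\<lambda>t. 1 - exp (- \<beta> * sqrt (1 - t\<^sup>2))"
     "\<lambda>t. \<beta> * exp (- \<beta> * sqrt (1 - t\<^sup>2)) * (t / sqrt (1 - t\<^sup>2))" \<beta>
    by (rule one_minus_exp_profile[OF assms])
  have e: "integral {-1..1} (\<lambda>t. (1 - exp (- \<beta> * sqrt (1 - t\<^sup>2))) * cos (w * t))
      = 2 * integral {0..1} (\<lambda>t. (1 - exp (- \<beta> * sqrt (1 - t\<^sup>2))) * cos (w * t))" for w
    by (rule integral_even_function) (auto intro!: continuous_intros)
  show "\<bar>integral {-1..1} (\<lambda>t. (1 - exp (- \<beta> * sqrt (1 - t\<^sup>2))) * cos (w * t))\<bar> \<le> 2 / w" if "w > 0"
  proof -
    have "(1 - exp (- \<beta>)) / w \<le> 1 / w" using that by (intro divide_right_mono) auto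
    then show ?thesis using cos_integral_le_inverse[OF that] unfolding e by simp
  qed
  show "\<bar>integral {-1..1} (\<lambda>t. (1 - exp (- \<beta> * sqrt (1 - t\<^sup>2))) * cos (w * t))\<bar>
      \<le> 4 * sqrt 2 * \<beta> / (w * sqrt w)" if "w \<ge> 1"
    using cos_integral_le[OF that] unfolding e by simp
qed

section \<open>Growth of the half circle cosh transform\<close>

text \<open>With \<open>p = sqrt (z / 2)\<close> this is \<open>p * (p - 1)\<^sup>2 * (p + 2) \<ge> 0\<close>. The parabola touches the root
  at \<open>z = 2\<close>; of all parabolas through the origin that touch the root, this one has the largest
  integral against \<open>exp (- z)\<close> over the half line.\<close>

lemma sqrt_ge_parabola:
  assumes "z \<ge> (0::real)" shows "sqrt 2 * (3 / 4 * z - z\<^sup>2 / 8) \<le> sqrt z"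
proof -
  define p where "p = sqrt (z / 2)"
  have p: "p \<ge> 0" "z = 2 * p\<^sup>2" using assms by (auto simp: p_def)
  have "0 \<le> p * ((p - 1)\<^sup>2 * (p + 2)) / 2" using p by simp
  also have "\<dots> = p - (3 / 4 * z - z\<^sup>2 / 8)"
    unfolding p(2) by (simp add: power2_eq_square field_simps)
  finally have "sqrt 2 * (3 / 4 * z - z\<^sup>2 / 8) \<le> sqrt 2 * p" by simp
  also have "\<dots> = sqrt z" using p by (simp add: real_sqrt_mult)
  finally show ?thesis .
qed

text \<open>The mass of the integrand concentrates at distance about \<open>1 / x\<close> from the endpoints. There, with
  \<open>z = x * (1 - u)\<close>, the weight \<open>sqrt (1 - u\<^sup>2) \<ge> sqrt (1 - u)\<close> is replaced by the parabola of
  \<open>sqrt_ge_parabola\<close>, which integrates against \<open>exp (x * u)\<close> in closed form.\<close>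

lemma circle_cosh_integral_ge:
  fixes x :: real
  assumes "x \<ge> 5"
  shows "integral {-1..1} (\<lambda>t. sqrt (1 - t\<^sup>2) * cosh (x * t)) \<ge> exp x / (sqrt 2 * (x * sqrt x))"
proof -
  let ?P = "\<lambda>u. sqrt 2 / sqrt x * (3 / 4 * (x * (1 - u)) - (x * (1 - u))\<^sup>2 / 8) * exp (x * u)"
  \<comment> \<open>an antiderivative of the minorant; its value at \<open>0\<close> is nonpositive as soon as \<open>x \<ge> 5\<close>\<close>
  let ?G = "\<lambda>u. sqrt 2 / sqrt x * (1 / 2 + 1 / 2 * (x * (1 - u)) - (x * (1 - u))\<^sup>2 / 8) * exp (x * u) / x"
  have x: "x > 0" using assms by simp
  have "(?P has_integral (?G 1 - ?G 0)) {0..1}"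
  proof (rule fundamental_theorem_of_calculus)
    fix u :: real
    have "(?G has_real_derivative ?P u) (at u within {0..1})"
      using x by (auto intro!: derivative_eq_intros) (simp add: field_simps power2_eq_square)
    then show "(?G has_vector_derivative ?P u) (at u within {0..1})"
      by (simp only: has_real_derivative_iff_has_vector_derivative)
  qed simp
  then have P_int: "?P integrable_on {0..1}" and "?G 1 - ?G 0 = integral {0..1} ?P"
    by (auto simp: has_integral_iff)
  note this(2)
  also have "integral {0..1} ?P \<le> integral {0..1} (\<lambda>t. 2 * (sqrt (1 - t\<^sup>2) * cosh (x * t)))"
  proof (rule integral_le[OF P_int])
    show "(\<lambda>t. 2 * (sqrt (1 - t\<^sup>2) * cosh (x * t))) integrable_on {0..1}"
      by (intro integrable_continuous_real continuous_intros)
    fix u :: real assume u: "u \<in> {0..1}"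
    define z where "z = x * (1 - u)"
    have "sqrt 2 / sqrt x * (3 / 4 * z - z\<^sup>2 / 8) \<le> sqrt z / sqrt x"
      using sqrt_ge_parabola[of z] u x by (simp add: z_def divide_right_mono)
    also have "\<dots> = sqrt (1 - u)" using x by (simp add: z_def real_sqrt_mult)
    also have "\<dots> \<le> sqrt (1 - u\<^sup>2)" using u by (simp add: power2_eq_square mult_left_le)
    finally have "?P u \<le> sqrt (1 - u\<^sup>2) * exp (x * u)"
      unfolding z_def by (rule mult_right_mono) simp
    also have "\<dots> \<le> sqrt (1 - u\<^sup>2) * (2 * cosh (x * u))"
      using u by (intro mult_left_mono) (auto simp: cosh_def abs_square_le_1)
    finally show "?P u \<le> 2 * (sqrt (1 - u\<^sup>2) * cosh (x * u))" by simp
  qed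
  also have "\<dots> = integral {-1..1} (\<lambda>t. sqrt (1 - t\<^sup>2) * cosh (x * t))"
    by (subst integral_even_function) (auto intro!: continuous_intros)
  finally have "?G 1 - ?G 0 \<le> integral {-1..1} (\<lambda>t. sqrt (1 - t\<^sup>2) * cosh (x * t))" .
  moreover have "?G 0 \<le> 0"
  proof -
    have "0 \<le> (x - 5) * (x + 1) / 8" using assms by simp
    also have "\<dots> = x\<^sup>2 / 8 - x / 2 - 5 / 8" by (simp add: field_simps power2_eq_square)
    finally have "1 / 2 + 1 / 2 * (x * (1 - 0)) - (x * (1 - 0))\<^sup>2 / 8 \<le> 0" by simp
    then show ?thesis using x
      by (intro divide_nonpos_pos mult_nonpos_nonneg mult_nonneg_nonpos) auto
  qed
  moreover have "?G 1 = exp x / (sqrt 2 * (x * sqrt x))"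
    using x by (simp add: field_simps)
  ultimately show ?thesis by linarith
qed

text \<open>With \<open>\<rho> = y / x\<close>, the claim is \<open>\<rho> powr (3 / 2) \<le> exp (x * (\<rho> - 1))\<close>, which follows
  from \<open>\<rho> \<le> exp (\<rho> - 1)\<close>.\<close>

lemma exp_over_three_halves_mono:
  fixes x y :: real
  assumes "2 \<le> x" "x \<le> y"
  shows "exp x / (x * sqrt x) \<le> exp y / (y * sqrt y)"
proof -
  define \<rho> where "\<rho> = y / x"
  have \<rho>: "\<rho> \<ge> 1" and y: "y = \<rho> * x" using assms by (auto simp: \<rho>_def)
  have "\<rho> * sqrt \<rho> \<le> \<rho> * \<rho>"
    using \<rho> by (intro mult_left_mono) (auto intro: real_le_lsqrt simp: power2_eq_square)
  also have "\<dots> \<le> exp (\<rho> - 1) * exp (\<rho> - 1)"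
    using \<rho> exp_ge_add_one_self[of "\<rho> - 1"] by (intro mult_mono) auto
  also have "\<dots> = exp (2 * (\<rho> - 1))" by (simp flip: exp_add)
  also have "2 * (\<rho> - 1) \<le> x * (\<rho> - 1)" using assms \<rho> by (intro mult_right_mono) auto
  then have "exp (2 * (\<rho> - 1)) \<le> exp (y - x)" unfolding y by (simp add: algebra_simps)
  finally have "\<rho> * sqrt \<rho> * exp x \<le> exp (y - x) * exp x" by (intro mult_right_mono) auto
  then have "\<rho> * sqrt \<rho> * exp x \<le> exp y" by (simp flip: exp_add)
  then have "\<rho> * sqrt \<rho> * exp x / (y * sqrt y) \<le> exp y / (y * sqrt y)"
    using assms by (intro divide_right_mono) auto
  moreover have "\<rho> * sqrt \<rho> * exp x / (y * sqrt y) = exp x / (x * sqrt x)"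
    using \<rho> assms unfolding y by (simp add: real_sqrt_mult)
  ultimately show ?thesis by simp
qed

text \<open>The exponent in the theorem is at least \<open>4 * pi * sqrt (1 / 5) > 5.6\<close>, its value for \<open>m = 2\<close> and
  \<open>\<sigma> = 5 / 4\<close>.\<close>

lemma exp_over_three_halves_ge:
  assumes "(x::real) \<ge> 5.6" shows "exp x / (x * sqrt x) \<ge> 2.4"
proof -
  have "sqrt 5.6 \<le> (2.37::real)" by (rule real_le_lsqrt) (auto simp: power2_eq_square)
  moreover have "(33::real) \<le> exp 5.6"
  proof -
    have "(33::real) \<le> (1 + 1.4) ^ 4" by (simp add: power_divide eval_nat_numeral)
    also have "\<dots> \<le> exp 1.4 ^ 4" by (intro power_mono exp_ge_add_one_self) auto
    also have "\<dots> = exp 5.6" by (simp flip: exp_of_nat_mult)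
    finally show ?thesis .
  qed
  ultimately have "33 / (5.6 * 2.37) \<le> exp 5.6 / (5.6 * sqrt (5.6::real))"
    by (intro frac_le mult_left_mono) auto
  then have "2.4 \<le> exp 5.6 / (5.6 * sqrt (5.6::real))" by simp
  also have "\<dots> \<le> exp x / (x * sqrt x)" using assms by (intro exp_over_three_halves_mono) auto
  finally show ?thesis .
qed

section \<open>The Fourier transform of the window\<close>

definition cosh_transform :: "real \<Rightarrow> real \<Rightarrow> real" where
  "cosh_transform \<beta> w = integral {-1..1} (\<lambda>t. (cosh (\<beta> * sqrt (1 - t\<^sup>2)) - 1) * cos (w * t))"

lemma integral_odd_function:
  fixes f :: "real \<Rightarrow> real"
  assumes "\<And>t. f (- t) = - f t"
  shows "integral {-1..1} f = 0"
  using Henstock_Kurzweil_Integration.integral_reflect_real[of 1 "-1" f] assms by simp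

text \<open>The window is even, so the imaginary part of its transform vanishes.\<close>

lemma fourier_phi_cosh:
  assumes "m > 0" "N1 > 0"
  shows "fourier (phi_cosh m \<beta> N1) v
    = of_real (real m / N1 / (cosh \<beta> - 1) * cosh_transform \<beta> (2 * pi * real m * v / N1))"
proof -
  define c where "c = real m / N1"
  define K where "K = 1 / (cosh \<beta> - 1)"
  define w where "w = 2 * pi * real m * v / N1"
  have c: "c > 0" using assms by (simp add: c_def)
  let ?G = "\<lambda>t::real. cosh (\<beta> * sqrt (1 - t\<^sup>2)) - 1"
  let ?f = "\<lambda>t. complex_of_real (K * ?G t * cos (w * t)) - \<i> * of_real (K * ?G t * sin (w * t))"
  have int_r: "((\<lambda>t. K * ?G t * cos (w * t)) has_integral (K * cosh_transform \<beta> w)) {-1..1}"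
    unfolding cosh_transform_def mult.assoc
    by (intro has_integral_mult_right integrable_integral integrable_continuous_real continuous_intros)
  have "integral {-1..1} (\<lambda>t. K * ?G t * sin (w * t)) = 0"
    by (rule integral_odd_function) simp
  moreover have "(\<lambda>t. K * ?G t * sin (w * t)) integrable_on {-1..1}"
    by (intro integrable_continuous_real continuous_intros)
  ultimately have int_i: "((\<lambda>t. K * ?G t * sin (w * t)) has_integral 0) {-1..1}"
    by (simp add: has_integral_iff)
  have "(?f has_integral (of_real (K * cosh_transform \<beta> w) - \<i> * of_real 0)) {-1..1}"
    using has_integral_linear[OF int_r bounded_linear_of_real, unfolded o_def]
      has_integral_linear[OF int_i bounded_linear_of_real, unfolded o_def]
    by (intro has_integral_diff has_integral_mult_right)
  then have int: "integral {-1..1} ?f = of_real (K * cosh_transform \<beta> w)"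
    by (simp add: integral_unique)
  have val: "complex_of_real (phi_cosh m \<beta> N1 (c * x)) * exp (- 2 * of_real pi * \<i> * of_real v * of_real (c * x))
      = indicator {-1..1} x *\<^sub>R ?f x" for x
  proof -
    have "N1 * (c * x) / real m = x" using assms by (simp add: c_def)
    moreover have "\<bar>c * x\<bar> < real m / N1 \<longleftrightarrow> \<bar>x\<bar> < 1"
      using assms by (simp add: c_def abs_mult field_simps)
    ultimately have "phi_cosh m \<beta> N1 (c * x) = (if \<bar>x\<bar> < 1 then K * ?G x else 0)"
      by (simp add: phi_cosh_def K_def)
    also have "\<dots> = indicator {-1..1} x * (K * ?G x)"
    proof (cases "\<bar>x\<bar> = 1")
      case True
      then have "x\<^sup>2 = 1" by (metis power2_abs power_one)
      then show ?thesis using True by simp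
    qed (auto simp: indicator_def)
    finally have phi: "phi_cosh m \<beta> N1 (c * x) = indicator {-1..1} x * (K * ?G x)" .
    have "- 2 * complex_of_real pi * \<i> * of_real v * of_real (c * x) = \<i> * of_real (- (w * x))"
      by (simp add: w_def c_def)
    then have "exp (- 2 * complex_of_real pi * \<i> * of_real v * of_real (c * x)) = cis (- (w * x))"
      by (simp only: cis_conv_exp)
    also have "\<dots> = of_real (cos (w * x)) - \<i> * of_real (sin (w * x))"
      by (simp add: complex_eq_iff)
    finally have phase: "exp (- 2 * complex_of_real pi * \<i> * of_real v * of_real (c * x))
        = of_real (cos (w * x)) - \<i> * of_real (sin (w * x))" .
    show ?thesis
      unfolding phi phase by (simp add: scaleR_conv_of_real algebra_simps)
  qed
  have cont: "continuous_on {-1..1} ?f" by (intro continuous_intros)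
  have "fourier (phi_cosh m \<beta> N1) v = \<bar>c\<bar> *\<^sub>R (LINT x|lborel. of_real (phi_cosh m \<beta> N1 (0 + c * x))
      * exp (- 2 * of_real pi * \<i> * of_real v * of_real (0 + c * x)))"
    unfolding fourier_def by (rule lborel_integral_real_affine) (use c in simp)
  also have "\<dots> = c *\<^sub>R (LINT x:{-1..1}|lborel. ?f x)"
    unfolding set_lebesgue_integral_def add_0 val using c by simp
  also have "(LINT x:{-1..1}|lborel. ?f x) = integral {-1..1} ?f"
    by (rule set_borel_integral_eq_integral(2)[OF borel_integrable_atLeastAtMost'[OF cont]])
  finally show ?thesis
    unfolding int by (simp add: c_def K_def w_def scaleR_conv_of_real)
qed

lemma cosh_transform_minus: "cosh_transform \<beta> (- w) = cosh_transform \<beta> w"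
  by (simp add: cosh_transform_def)

lemma cosh_transform_abs: "cosh_transform \<beta> \<bar>w\<bar> = cosh_transform \<beta> w"
  by (simp add: abs_if cosh_transform_minus)

text \<open>The term \<open>sinh\<close> carries the Bessel function; the rest is bounded and has no closed form.\<close>

lemma cosh_transform_split:
  "cosh_transform \<beta> w = integral {-1..1} (\<lambda>t. sinh (\<beta> * sqrt (1 - t\<^sup>2)) * cos (w * t))
     - integral {-1..1} (\<lambda>t. (1 - exp (- \<beta> * sqrt (1 - t\<^sup>2))) * cos (w * t))"
proof -
  have "cosh z - 1 = sinh z - (1 - exp (- z))" for z :: real
    using cosh_minus_sinh[of z] by simp
  then have "cosh_transform \<beta> w = integral {-1..1} (\<lambda>t. sinh (\<beta> * sqrt (1 - t\<^sup>2)) * cos (w * t)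
     - (1 - exp (- \<beta> * sqrt (1 - t\<^sup>2))) * cos (w * t))"
    unfolding cosh_transform_def by (simp add: algebra_simps)
  also have "\<dots> = integral {-1..1} (\<lambda>t. sinh (\<beta> * sqrt (1 - t\<^sup>2)) * cos (w * t))
     - integral {-1..1} (\<lambda>t. (1 - exp (- \<beta> * sqrt (1 - t\<^sup>2))) * cos (w * t))"
    by (intro integral_diff integrable_continuous_real continuous_intros)
  finally show ?thesis .
qed

text \<open>The bound for the aliases closest to \<open>\<beta>\<close>, where the decay estimate below is void. The constant
  \<open>pi * \<beta> / 2\<close> is the exact value of the \<open>sinh\<close> part at \<open>w = \<beta>\<close>.\<close>

lemma abs_cosh_transform_le:
  assumes "\<beta> > 0" "w \<ge> \<beta>"
  shows "\<bar>cosh_transform \<beta> w\<bar> \<le> pi * \<beta> / 2 + 2 / \<beta>"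
proof -
  define y where "y = sqrt (w\<^sup>2 - \<beta>\<^sup>2)"
  have "\<beta>\<^sup>2 \<le> w\<^sup>2" using assms by (intro power_mono) auto
  then have "w\<^sup>2 = \<beta>\<^sup>2 + y\<^sup>2" by (simp add: y_def)
  note S = sinh_cos_integral_above[OF this]
  have "\<bar>integral {-1..1} (\<lambda>t. sqrt (1 - t\<^sup>2) * cos (y * t))\<bar> \<le> integral {-1..1} (\<lambda>t. sqrt (1 - t\<^sup>2))"
    unfolding real_norm_def[symmetric]
  proof (rule integral_norm_bound_integral)
    fix t :: real assume "t \<in> {-1..1}"
    then have "0 \<le> sqrt (1 - t\<^sup>2)" by (simp add: abs_square_le_1 abs_le_iff)
    then show "norm (sqrt (1 - t\<^sup>2) * cos (y * t)) \<le> sqrt (1 - t\<^sup>2)"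
      using mult_left_le[of "\<bar>cos (y * t)\<bar>" "sqrt (1 - t\<^sup>2)"] by (simp add: abs_mult)
  qed (auto intro!: integrable_continuous_real continuous_intros)
  also have "\<dots> = pi / 2" using moment_0_0 by (simp add: moment_def)
  finally have "\<beta> * \<bar>integral {-1..1} (\<lambda>t. sqrt (1 - t\<^sup>2) * cos (y * t))\<bar> \<le> \<beta> * (pi / 2)"
    using assms by (intro mult_left_mono) auto
  moreover have "2 / w \<le> 2 / \<beta>" using assms by (intro divide_left_mono) auto
  moreover have "\<bar>integral {-1..1} (\<lambda>t. (1 - exp (- \<beta> * sqrt (1 - t\<^sup>2))) * cos (w * t))\<bar> \<le> 2 / w"
    using assms by (intro one_minus_exp_cos_integral_le) auto
  moreover have "\<bar>\<beta> * i\<bar> = \<beta> * \<bar>i\<bar>" for i using assms by (simp add: abs_mult)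
  ultimately show ?thesis unfolding cosh_transform_split S
    by (smt (verit, best) mult.commute times_divide_eq_right)
qed

text \<open>The \<open>sinh\<close> part decays like the power \<open>-3 / 2\<close> of \<open>sqrt (w\<^sup>2 - \<beta>\<^sup>2)\<close>, the rest like that
  power of \<open>w\<close>, and both of these are at least \<open>z\<close>.\<close>

lemma abs_cosh_transform_decay:
  assumes "\<beta> > 0" "w > 0" "z \<ge> 1" "\<beta>\<^sup>2 + z\<^sup>2 \<le> w\<^sup>2"
  shows "\<bar>cosh_transform \<beta> w\<bar> \<le> 8 * sqrt 2 * \<beta> / (z * sqrt z)"
proof -
  define y where "y = sqrt (w\<^sup>2 - \<beta>\<^sup>2)"
  have "\<beta>\<^sup>2 \<le> w\<^sup>2" using assms by (smt (verit) zero_le_power2)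
  then have "w\<^sup>2 = \<beta>\<^sup>2 + y\<^sup>2" by (simp add: y_def)
  note S = sinh_cos_integral_above[OF this]
  have y: "y \<ge> z" unfolding y_def using assms by (intro real_le_rsqrt) simp
  have w: "w \<ge> z" 
  proof (rule power2_le_imp_le)
    show "z\<^sup>2 \<le> w\<^sup>2" using assms(4) by (smt (verit) zero_le_power2)
  qed (use assms in simp)
  have frac: "4 * sqrt 2 / (u * sqrt u) \<le> 4 * sqrt 2 / (z * sqrt z)" if "u \<ge> z" for u
    using that assms by (intro divide_left_mono mult_mono) auto
  have "\<bar>integral {-1..1} (\<lambda>t. sqrt (1 - t\<^sup>2) * cos (y * t))\<bar> \<le> 4 * sqrt 2 / (z * sqrt z)"
    using circle_cos_integral_le[of y] frac[OF y] y assms by linarith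
  then have "\<beta> * \<bar>integral {-1..1} (\<lambda>t. sqrt (1 - t\<^sup>2) * cos (y * t))\<bar> \<le> \<beta> * (4 * sqrt 2 / (z * sqrt z))"
    using assms by (intro mult_left_mono) auto
  then have 1: "\<bar>\<beta> * integral {-1..1} (\<lambda>t. sqrt (1 - t\<^sup>2) * cos (y * t))\<bar> \<le> \<beta> * (4 * sqrt 2 / (z * sqrt z))"
    using assms by (simp add: abs_mult)
  have "\<bar>integral {-1..1} (\<lambda>t. (1 - exp (- \<beta> * sqrt (1 - t\<^sup>2))) * cos (w * t))\<bar>
      \<le> \<beta> * (4 * sqrt 2 / (w * sqrt w))"
    using one_minus_exp_cos_integral_le(2)[of \<beta> w] w assms by (simp add: mult_ac)
  also have "\<dots> \<le> \<beta> * (4 * sqrt 2 / (z * sqrt z))"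
    using frac[OF w] assms by (intro mult_left_mono) auto
  finally have 2: "\<bar>integral {-1..1} (\<lambda>t. (1 - exp (- \<beta> * sqrt (1 - t\<^sup>2))) * cos (w * t))\<bar>
      \<le> \<beta> * (4 * sqrt 2 / (z * sqrt z))" .
  have "8 * sqrt 2 * \<beta> / (z * sqrt z) = \<beta> * (4 * sqrt 2 / (z * sqrt z)) + \<beta> * (4 * sqrt 2 / (z * sqrt z))"
    by simp
  then show ?thesis unfolding cosh_transform_split S using 1 2 by linarith
qed

lemma cosh_transform_ge:
  assumes "\<beta> > 0" "x0 \<ge> 5" "w\<^sup>2 + x0\<^sup>2 \<le> \<beta>\<^sup>2"
  shows "cosh_transform \<beta> w \<ge> \<beta> * (exp x0 / (sqrt 2 * (x0 * sqrt x0))) - 2"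
proof -
  define x where "x = sqrt (\<beta>\<^sup>2 - w\<^sup>2)"
  have x: "x \<ge> x0" unfolding x_def using assms by (intro real_le_rsqrt) simp
  have "w\<^sup>2 \<le> \<beta>\<^sup>2" using assms by (smt (verit) zero_le_power2)
  then have "\<beta>\<^sup>2 = w\<^sup>2 + x\<^sup>2" by (simp add: x_def)
  note S = sinh_cos_integral_below[OF this]
  have "exp x0 / (sqrt 2 * (x0 * sqrt x0)) = exp x0 / (x0 * sqrt x0) / sqrt 2" by simp
  also have "\<dots> \<le> exp x / (x * sqrt x) / sqrt 2"
    using x assms by (intro divide_right_mono exp_over_three_halves_mono) auto
  also have "\<dots> = exp x / (sqrt 2 * (x * sqrt x))" by simp
  also have "\<dots> \<le> integral {-1..1} (\<lambda>t. sqrt (1 - t\<^sup>2) * cosh (x * t))"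
    using x assms by (intro circle_cosh_integral_ge) simp
  finally have "\<beta> * (exp x0 / (sqrt 2 * (x0 * sqrt x0))) \<le> \<beta> * integral {-1..1} (\<lambda>t. sqrt (1 - t\<^sup>2) * cosh (x * t))"
    using assms by (intro mult_left_mono) auto
  moreover have "\<bar>integral {-1..1} (\<lambda>t. (1 - exp (- \<beta> * sqrt (1 - t\<^sup>2))) * cos (w * t))\<bar>
      \<le> integral {-1..1} (\<lambda>t::real. 1)"
    unfolding real_norm_def[symmetric]
  proof (rule integral_norm_bound_integral)
    fix t :: real assume "t \<in> {-1..1}"
    then have "0 \<le> sqrt (1 - t\<^sup>2)" by (simp add: abs_square_le_1 abs_le_iff)
    then have "exp (- \<beta> * sqrt (1 - t\<^sup>2)) \<le> 1" using assms by simp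
    then show "norm ((1 - exp (- \<beta> * sqrt (1 - t\<^sup>2))) * cos (w * t)) \<le> 1"
      by (simp add: abs_mult mult_le_one)
  qed (auto intro!: integrable_continuous_real continuous_intros)
  ultimately show ?thesis unfolding cosh_transform_split S by simp
qed

section \<open>Summation over the aliases\<close>

text \<open>The right-hand side is the integral of \<open>x powr (- 3 / 2)\<close> over the unit interval centred at
  \<open>c\<close>, so this is the midpoint inequality for a convex function.\<close>

lemma inverse_three_halves_le_telescope:
  fixes c :: real assumes "c \<ge> 1"
  shows "1 / (c * sqrt c) \<le> 2 / sqrt (c - 1 / 2) - 2 / sqrt (c + 1 / 2)"
proof -
  define p q s where "p = sqrt (c - 1 / 2)" and "q = sqrt (c + 1 / 2)" and "s = sqrt c"
  have pos: "p > 0" "q > 0" "s > 0" and sq: "p\<^sup>2 = c - 1 / 2" "q\<^sup>2 = c + 1 / 2" "s\<^sup>2 = c"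
    using assms by (auto simp: p_def q_def s_def)
  have qp: "(q - p) * (q + p) = 1" using sq by (simp add: power2_eq_square algebra_simps)
  have pq: "p * q \<le> s\<^sup>2"
  proof (rule power2_le_imp_le)
    have "(p * q)\<^sup>2 = (c - 1 / 2) * (c + 1 / 2)" using sq by (simp add: power_mult_distrib)
    also have "\<dots> \<le> c\<^sup>2" by (simp add: power2_eq_square algebra_simps)
    finally show "(p * q)\<^sup>2 \<le> (s\<^sup>2)\<^sup>2" using sq by simp
  qed simp
  have "p + q \<le> 2 * s"
  proof (rule power2_le_imp_le)
    have "(p + q)\<^sup>2 = 2 * c + 2 * (p * q)" using sq by (simp add: power2_eq_square algebra_simps)
    also have "\<dots> \<le> (2 * s)\<^sup>2" using pq sq by (simp add: power2_eq_square)
    finally show "(p + q)\<^sup>2 \<le> (2 * s)\<^sup>2" .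
  qed (use pos in simp)
  then have "p * q * (p + q) \<le> s\<^sup>2 * (2 * s)" using pq pos by (intro mult_mono) auto
  then have "1 / (s\<^sup>2 * s) \<le> 2 / (p * q * (p + q))"
    using pos by (simp add: divide_simps)
  also have "\<dots> = 2 * ((q - p) * (q + p)) / (p * q * (p + q))" unfolding qp by simp
  also have "\<dots> = 2 / p - 2 / q" using pos by (simp add: divide_simps) (simp add: algebra_simps)
  finally show ?thesis unfolding sq(3) unfolding p_def q_def s_def .
qed

lemma sum_inverse_three_halves_le:
  "(\<Sum>k<M. 1 / (real (Suc k) * sqrt (real (Suc k)))) \<le> 2 * sqrt 2"
proof -
  have "(\<Sum>k<M. 1 / (real (Suc k) * sqrt (real (Suc k)))) \<le> 2 * sqrt 2 - 2 / sqrt (real M + 1 / 2)"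
  proof (induction M)
    case 0
    show ?case by (simp add: real_sqrt_divide)
  next
    case (Suc M)
    have "real (Suc M) - 1 / 2 = real M + 1 / 2" by simp
    then show ?case
      using Suc inverse_three_halves_le_telescope[of "real (Suc M)"] by (simp only: sum.lessThan_Suc) simp
  qed
  also have "\<dots> \<le> 2 * sqrt 2" by simp
  finally show ?thesis .
qed

lemma sum_nonzero_ints_le:
  fixes v :: "nat \<Rightarrow> real"
  assumes F: "finite F" "F \<subseteq> UNIV - {0}" and v: "\<And>k. v k \<ge> 0" "\<And>M. (\<Sum>k<M. v k) \<le> C"
  shows "(\<Sum>r\<in>F. v (nat \<bar>r\<bar> - 1)) \<le> 2 * C"
proof -
  have half: "(\<Sum>r\<in>A. v (nat \<bar>r\<bar> - 1)) \<le> C"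
    if A: "finite A" "inj_on (\<lambda>r. nat \<bar>r\<bar> - 1) A" for A :: "int set"
  proof -
    let ?B = "(\<lambda>r. nat \<bar>r\<bar> - 1) ` A"
    have "(\<Sum>r\<in>A. v (nat \<bar>r\<bar> - 1)) = sum v ?B"
      using A(2) by (simp add: sum.reindex)
    also have "\<dots> \<le> (\<Sum>k<Suc (Max ?B). v k)"
      using A v(1) by (intro sum_mono2) (auto simp: less_Suc_eq_le)
    also have "\<dots> \<le> C" by (rule v)
    finally show ?thesis .
  qed
  have "(\<Sum>r\<in>F. v (nat \<bar>r\<bar> - 1))
      = (\<Sum>r\<in>F \<inter> {0<..}. v (nat \<bar>r\<bar> - 1)) + (\<Sum>r\<in>F \<inter> {..<0}. v (nat \<bar>r\<bar> - 1))"
    using F by (subst sum.union_disjoint[symmetric]) (auto intro!: sum.cong)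
  also have "\<dots> \<le> C + C"
    using F by (intro add_mono half) (auto simp: inj_on_def)
  finally show ?thesis by simp
qed

text \<open>Here \<open>\<nu> = n / N1\<close> and \<open>e = 1 / (2 * \<sigma>)\<close>. With \<open>k = \<bar>r\<bar> - 1\<close>, the aliased frequency \<open>w\<close> is
  at least \<open>W * (k + 1 - e)\<close>. For \<open>k = 0\<close> this is exactly \<open>\<beta>\<close>, and for \<open>k > 0\<close> it gives
  \<open>w\<^sup>2 - \<beta>\<^sup>2 \<ge> (W * k)\<^sup>2\<close>. So the terms are dominated by two copies of the sequence \<open>v\<close>, and
  \<open>64 = 2 * 8 * sqrt 2 * 2 * sqrt 2\<close>.\<close>

lemma aliasing_sum_le:
  fixes W :: real and g :: "int \<Rightarrow> complex"
  assumes W: "W \<ge> 1" and e: "0 \<le> e" "e < 1" and nu: "\<bar>\<nu>\<bar> \<le> e" and beta: "\<beta> = W * (1 - e)"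
    and D: "D > 0"
    and g: "\<And>r. r \<noteq> 0 \<Longrightarrow> norm (g r) = \<bar>cosh_transform \<beta> (W * (\<nu> + of_int r))\<bar> / D"
  shows "norm (\<Sum>\<^sub>\<infinity>r\<in>UNIV - {0}. g r) \<le> (pi * \<beta> + 4 / \<beta> + 64 * \<beta> / (W * sqrt W)) / D"
proof -
  have b0: "\<beta> > 0" using W e beta by simp
  define d where "d = 8 * sqrt 2 * \<beta> / (W * sqrt W)"
  have d: "d \<ge> 0" using b0 W by (simp add: d_def)
  define v :: "nat \<Rightarrow> real" where
    "v k = (if k = 0 then pi * \<beta> / 2 + 2 / \<beta> else d * (1 / (real k * sqrt (real k))))" for k
  have v_nonneg: "v k \<ge> 0" for k using b0 d by (simp add: v_def)
  have v_sum: "(\<Sum>k<M. v k) \<le> pi * \<beta> / 2 + 2 / \<beta> + d * (2 * sqrt 2)" for M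
  proof -
    have "(\<Sum>k<M. v k) \<le> (\<Sum>k<Suc M. v k)" using v_nonneg by simp
    also have "\<dots> = pi * \<beta> / 2 + 2 / \<beta> + d * (\<Sum>k<M. 1 / (real (Suc k) * sqrt (real (Suc k))))"
      by (subst sum.lessThan_Suc_shift) (simp add: v_def sum_distrib_left)
    also have "\<dots> \<le> pi * \<beta> / 2 + 2 / \<beta> + d * (2 * sqrt 2)"
      using d by (intro add_left_mono mult_left_mono sum_inverse_three_halves_le)
    finally show ?thesis .
  qed
  have term_le: "norm (g r) \<le> v (nat \<bar>r\<bar> - 1) / D" if r: "r \<noteq> 0" for r
  proof -
    define k where "k = nat \<bar>r\<bar> - 1"
    have rk: "\<bar>real_of_int r\<bar> = real k + 1" using r by (simp add: k_def of_nat_diff nat_abs_int_diff)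
    define w where "w = W * \<bar>\<nu> + of_int r\<bar>"
    have w_ge: "w \<ge> W * (real k + 1 - e)"
      unfolding w_def using W nu rk by (intro mult_left_mono) auto
    have eq: "\<bar>cosh_transform \<beta> (W * (\<nu> + of_int r))\<bar> = \<bar>cosh_transform \<beta> w\<bar>"
      using cosh_transform_abs[of \<beta> "W * (\<nu> + of_int r)"] W by (simp add: w_def abs_mult)
    have "\<bar>cosh_transform \<beta> w\<bar> \<le> v k"
    proof (cases "k = 0")
      case True
      then have "w \<ge> \<beta>" using w_ge beta by simp
      then show ?thesis using abs_cosh_transform_le[OF b0] True by (simp add: v_def)
    next
      case False
      have "\<beta>\<^sup>2 + (W * real k)\<^sup>2 \<le> (W * (real k + 1 - e))\<^sup>2"
      proof -
        have "(W * (real k + 1 - e))\<^sup>2 - (\<beta>\<^sup>2 + (W * real k)\<^sup>2) = 2 * W\<^sup>2 * (real k * (1 - e))"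
          unfolding beta by (simp add: power2_eq_square algebra_simps)
        moreover have "\<dots> \<ge> 0" using e by simp
        ultimately show ?thesis by linarith
      qed
      also have "\<dots> \<le> w\<^sup>2" using w_ge W e by (intro power_mono) auto
      finally have "\<beta>\<^sup>2 + (W * real k)\<^sup>2 \<le> w\<^sup>2" .
      moreover have "W * real k \<ge> 1" using W False mult_mono[of 1 W 1 "real k"] by simp
      moreover have "w > 0"
        using w_ge W e False by (smt (verit, best) mult_pos_pos of_nat_0_le_iff)
      ultimately have "\<bar>cosh_transform \<beta> w\<bar> \<le> 8 * sqrt 2 * \<beta> / (W * real k * sqrt (W * real k))"
        using b0 by (intro abs_cosh_transform_decay)
      also have "\<dots> = v k" using False by (simp add: v_def d_def real_sqrt_mult)
      finally show ?thesis .
    qed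
    then show ?thesis using D r by (simp add: g eq k_def divide_right_mono)
  qed
  have finite_le: "(\<Sum>r\<in>F. norm (g r)) \<le> (pi * \<beta> + 4 / \<beta> + 64 * \<beta> / (W * sqrt W)) / D"
    if F: "finite F" "F \<subseteq> UNIV - {0}" for F
  proof -
    have "(\<Sum>r\<in>F. norm (g r)) \<le> (\<Sum>r\<in>F. v (nat \<bar>r\<bar> - 1) / D)"
      using F by (intro sum_mono term_le) auto
    also have "\<dots> = (\<Sum>r\<in>F. v (nat \<bar>r\<bar> - 1)) / D" by (simp add: sum_divide_distrib)
    also have "\<dots> \<le> (2 * (pi * \<beta> / 2 + 2 / \<beta> + d * (2 * sqrt 2))) / D"
      using D by (intro divide_right_mono sum_nonzero_ints_le F v_nonneg v_sum) auto
    also have "2 * (pi * \<beta> / 2 + 2 / \<beta> + d * (2 * sqrt 2)) = pi * \<beta> + 4 / \<beta> + 64 * \<beta> / (W * sqrt W)"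
      by (simp add: d_def algebra_simps)
    finally show ?thesis .
  qed
  have abs_summable: "(\<lambda>r. norm (g r)) summable_on (UNIV - {0})"
    by (rule nonneg_bdd_above_summable_on) (auto intro!: bdd_aboveI2 finite_le)
  have "norm (\<Sum>\<^sub>\<infinity>r\<in>UNIV - {0}. g r) \<le> (\<Sum>\<^sub>\<infinity>r\<in>UNIV - {0}. norm (g r))"
    by (rule norm_infsum_bound[OF abs_summable])
  also have "\<dots> \<le> (pi * \<beta> + 4 / \<beta> + 64 * \<beta> / (W * sqrt W)) / D"
    by (rule infsum_le_finite_sums[OF abs_summable finite_le])
  finally show ?thesis .
qed

section \<open>The error constant\<close>

lemma gamma_const_bounds:
  assumes "\<beta> > 0" shows "0 \<le> gamma_const \<beta>" "gamma_const \<beta> \<le> 1"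
proof -
  have cont: "continuous_on {0..1} (\<lambda>t. exp (- \<beta> * sqrt (1 - t\<^sup>2)))" by (intro continuous_intros)
  have eq: "gamma_const \<beta> = integral {0..1} (\<lambda>t. exp (- \<beta> * sqrt (1 - t\<^sup>2)))"
    unfolding gamma_const_def
    by (rule set_borel_integral_eq_integral(2)[OF borel_integrable_atLeastAtMost'[OF cont]])
  show "0 \<le> gamma_const \<beta>" unfolding eq
    by (intro Henstock_Kurzweil_Integration.integral_nonneg integrable_continuous_real cont) simp
  have "gamma_const \<beta> \<le> integral {0..1} (\<lambda>t::real. 1)" unfolding eq
  proof (rule integral_le)
    fix t :: real assume "t \<in> {0..1}"
    then have "0 \<le> sqrt (1 - t\<^sup>2)" by (simp add: abs_square_le_1 abs_le_iff)
    then show "exp (- \<beta> * sqrt (1 - t\<^sup>2)) \<le> 1" using assms by simp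
  next
    show "(\<lambda>t. exp (- \<beta> * sqrt (1 - t\<^sup>2))) integrable_on {0..1}"
      by (rule integrable_continuous_real[OF cont])
  qed (rule integrable_const_ivl)
  then show "gamma_const \<beta> \<le> 1" by simp
qed

lemma E1_nonneg:
  assumes "x \<ge> 0" shows "E1 x \<ge> 0"
  unfolding E1_def set_lebesgue_integral_def
  using assms by (intro Bochner_Integration.integral_nonneg) (auto simp: indicator_def)

text \<open>The bracket in the theorem, in terms of the quantity \<open>exp x / x powr (3 / 2)\<close> that the lower
  bound for the transform produces.\<close>

lemma main_term_eq:
  assumes "m > 0" "c > 0" "W = 2 * pi * real m"
  shows "sqrt pi / (5 * sqrt (2 * real m)) * a * c powr (- 3 / 4) * exp (W * sqrt c)
     = pi / 5 * (W * a) * (exp (W * sqrt c) / (W * sqrt c * sqrt (W * sqrt c)))"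
proof -
  define z where "z = sqrt (sqrt c)"
  have z: "z > 0" and zz: "sqrt c = z * z" using assms by (auto simp: z_def)
  have "c powr (3 / 4) = c powr (1 / 2) * (c powr (1 / 2)) powr (1 / 2)"
    using powr_add[of c "1 / 2" "1 / 4"] by (simp add: powr_powr)
  then have c34: "c powr (3 / 4) = z * z * z"
    using assms by (simp add: powr_half_sqrt flip: zz z_def)
  have "c powr (- 3 / 4) = c powr (- (3 / 4))" by simp
  also have "\<dots> = 1 / (z * z * z)" unfolding powr_minus c34 by (simp add: divide_inverse)
  finally have c34': "c powr (- 3 / 4) = 1 / (z * z * z)" .
  have root: "sqrt (W * sqrt c) = sqrt pi * sqrt (2 * real m) * z"
    using assms(3) by (simp add: real_sqrt_mult mult_ac z_def)
  have "p / (5 * q) * a * (1 / (z * z * z)) * E = p * p / 5 * (W * a) * (E / (W * (z * z) * (p * q * z)))"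
    if "p > 0" "q > 0" "W > 0" for p q E :: real
    using that z by (simp add: field_simps)
  from this[of "sqrt pi" "sqrt (2 * real m)" "exp (W * (z * z))"] show ?thesis
    unfolding c34' root unfolding zz using assms(1) by (simp add: assms(3))
qed

text \<open>Multiplied by \<open>\<beta> / (2 * m) = pi * a\<close>, the summands of \<open>b_const\<close> are compared as follows: the
  first is \<open>pi * \<beta>\<close>; the second is at least \<open>10 * pi * a / sqrt W\<close>, about half of the alias
  tail; the third, of the larger order \<open>W powr (- 1 / 4)\<close>, pays for the other half and for
  \<open>4 / \<beta>\<close>. The last three are nonnegative.\<close>

lemma b_const_ge:
  assumes s: "\<sigma> \<ge> 5 / 4" and m: "m \<ge> 2" and W: "W = 2 * pi * real m"
    and a: "a = 1 - 1 / (2 * \<sigma>)" and beta: "\<beta> = W * a"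
  shows "pi * \<beta> + 4 / \<beta> + 64 * \<beta> / (W * sqrt W) \<le> \<beta> * b_const m \<sigma> \<beta> / (2 * real m)"
proof -
  have a_bounds: "0.6 \<le> a" "a < 1"
    using s by (auto simp: a field_simps)
  have W_ge: "W \<ge> 12.56" using m pi_approx mult_mono[of "3.14" pi 2 "real m"] by (simp add: W)
  have pos: "W > 0" "\<beta> > 0" using W_ge a_bounds beta by auto
  \<comment> \<open>the fourth root in the third summand of \<open>b_const\<close>; all error terms become powers of it\<close>
  define q where "q = root 4 (5 / W)"
  have q4: "q ^ 4 = 5 / W" and q0: "q > 0" using pos by (auto simp: q_def)
  have q_le: "q \<le> 0.795"
  proof -
    have "5 / W \<le> 5 / 12.56" using W_ge by (intro divide_left_mono) auto
    also have "\<dots> \<le> 0.795 ^ 4" by (simp add: eval_nat_numeral)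
    finally show ?thesis unfolding q4[symmetric] using power_le_imp_le_base[of q 3 "0.795"] by (simp add: eval_nat_numeral)
  qed
  define t3 where "t3 = (1 + 1 / exp 1) * (1 / pi) * q * (4 * \<sigma> / (2 * \<sigma> - 1) + 8) * a powr (- 1 / 4)"
  define rest where "rest = 8 * \<sigma> / ((2 * \<sigma> - 1) * pi * \<beta>) * exp (- sqrt (2 * pi * real m - pi * real m / \<sigma>))
     + 8 / (pi * \<beta>) * E1 (sqrt (2 * pi * real m - pi * real m / \<sigma>))
     + (4 * pi * real m + 2) / (\<beta> * pi) * (exp (- sqrt 2 * \<beta>) + 1 / 2)
         * exp (- 2 * pi * real m + pi * real m / \<sigma>)"
  have b_eq: "b_const m \<sigma> \<beta> = W + 10 / sqrt W * a powr (- 1 / 2) + t3 + rest"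
    unfolding b_const_def t3_def rest_def q_def W a by simp
  have "pi * real m / \<sigma> \<le> pi * real m / (1 / 2)"
    using s by (intro divide_left_mono) auto
  then have "E1 (sqrt (2 * pi * real m - pi * real m / \<sigma>)) \<ge> 0"
    by (intro E1_nonneg) simp
  moreover have "8 * \<sigma> / ((2 * \<sigma> - 1) * pi * \<beta>) \<ge> 0" "8 / (pi * \<beta>) \<ge> 0"
    "(4 * pi * real m + 2) / (\<beta> * pi) \<ge> 0" "exp (- sqrt 2 * \<beta>) + 1 / 2 \<ge> 0"
    using s pos by (auto intro!: add_nonneg_nonneg)
  ultimately have "rest \<ge> 0"
    unfolding rest_def
    by (auto intro: add_nonneg_nonneg[OF add_nonneg_nonneg[OF mult_nonneg_nonneg mult_nonneg_nonneg]
        mult_nonneg_nonneg[OF mult_nonneg_nonneg]] simp only: exp_ge_zero)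
  have powr_ge: "a powr (- p) \<ge> 1" if "p \<ge> 0" for p
    using a_bounds that powr_mono2'[of "- p" a 1] by simp
  have second: "10 / sqrt W * a powr (- 1 / 2) \<ge> 10 / sqrt W * 1"
    using powr_ge[of "1/2"] pos by (intro mult_left_mono) auto
  have third: "t3 \<ge> 1.36 / pi * q * (2 / a + 8)"
  proof -
    have e: "1.36 \<le> 1 + 1 / exp (1::real)"
      using e_less_272 by (simp add: field_simps)
    have a2: "4 * \<sigma> / (2 * \<sigma> - 1) = 2 / a" using s by (simp add: a field_simps)
    have "1.36 * (1 / pi) * q * (2 / a + 8) * 1 \<le> t3"
      unfolding t3_def a2 using e q0 a_bounds powr_ge[of "1/4"] by (intro mult_mono) auto
    then show ?thesis by simp
  qed
  have key: "4 / (W * a) + 32.6 * a / sqrt W \<le> 1.36 * q * (2 + 8 * a)"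
  proof -
    have W_eq: "W = 5 / q ^ 4" unfolding q4 using pos by simp
    have "q ^ 4 = q * q ^ 3" by (simp flip: power_Suc)
    then have "4 / (W * a) = q * (4 * q ^ 3 / (5 * a))"
      unfolding W_eq by simp
    also have "4 * q ^ 3 / (5 * a) \<le> 4 * 0.795 ^ 3 / (5 * 0.6)"
      using q0 q_le a_bounds by (intro frac_le mult_mono power_mono) auto
    also have "\<dots> \<le> 0.7" by (simp add: eval_nat_numeral)
    finally have 1: "4 / (W * a) \<le> q * 0.7" using q0 by simp
    have "sqrt (q ^ 4) = q\<^sup>2" by (rule real_sqrt_unique) auto
    then have "sqrt W = sqrt 5 / q\<^sup>2" unfolding W_eq real_sqrt_divide by simp
    then have "32.6 * a / sqrt W = q * a * (32.6 * q / sqrt 5)"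
      by (simp only: power2_eq_square divide_divide_eq_right times_divide_eq_right mult_ac)
    also have "32.6 * q / sqrt 5 \<le> 32.6 * 0.795 / 2.23"
      using q0 q_le by (intro frac_le mult_left_mono real_le_rsqrt) (auto simp: power2_eq_square)
    also have "\<dots> \<le> 11.7" by simp
    finally have 2: "32.6 * a / sqrt W \<le> q * a * 11.7" using q0 a_bounds by simp
    have "q * 0.7 + q * a * 11.7 = q * (0.7 + 11.7 * a)" by (simp add: algebra_simps)
    also have "\<dots> \<le> q * (1.36 * (2 + 8 * a))" using q0 a_bounds by (intro mult_left_mono) auto
    also have "\<dots> = 1.36 * q * (2 + 8 * a)" by (simp only: mult_ac)
    finally show ?thesis using 1 2 by linarith
  qed
  have pa: "\<beta> / (2 * real m) = pi * a" unfolding beta W using m by simp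
  have "W + 10 / sqrt W + 1.36 / pi * q * (2 / a + 8) \<le> b_const m \<sigma> \<beta>"
    unfolding b_eq using second third \<open>rest \<ge> 0\<close> by simp
  then have "pi * a * (W + 10 / sqrt W + 1.36 / pi * q * (2 / a + 8)) \<le> pi * a * b_const m \<sigma> \<beta>"
    using a_bounds by (intro mult_left_mono) auto
  also have "\<dots> = \<beta> * b_const m \<sigma> \<beta> / (2 * real m)" unfolding pa[symmetric] by simp
  finally have main: "pi * a * (W + 10 / sqrt W + 1.36 / pi * q * (2 / a + 8)) \<le> \<beta> * b_const m \<sigma> \<beta> / (2 * real m)" .
  have "pi * a * (W + 10 / sqrt W + 1.36 / pi * q * (2 / a + 8))
      = pi * \<beta> + 10 * pi * a / sqrt W + 1.36 * q * (2 + 8 * a)"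
  proof -
    have "pi * a * (1.36 / pi * q * (2 / a + 8)) = 1.36 * q * (a * (2 / a + 8))" by simp
    also have "a * (2 / a + 8) = 2 + 8 * a" using a_bounds by (simp add: distrib_left)
    finally show ?thesis by (simp only: distrib_left beta) (simp add: mult_ac)
  qed
  moreover have "64 * \<beta> / (W * sqrt W) = 64 * a / sqrt W" using pos by (simp add: beta)
  moreover have "64 * a / sqrt W \<le> 10 * pi * a / sqrt W + 32.6 * a / sqrt W"
  proof -
    have "64 * a \<le> (10 * pi + 32.6) * a" using a_bounds pi_approx by (intro mult_right_mono) auto
    then have "64 * a / sqrt W \<le> (10 * pi + 32.6) * a / sqrt W" using pos by (intro divide_right_mono) auto
    then show ?thesis by (simp add: algebra_simps add_divide_distrib)
  qed
  moreover have "4 / \<beta> = 4 / (W * a)" by (simp add: beta)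
  ultimately show ?thesis using main key by linarith
qed

theorem theorem7p4:
  fixes \<sigma> b \<beta> :: real and m :: nat
  assumes "\<sigma> \<ge> 5 / 4"
    and "m \<ge> 2"
    and "b = 2 * pi * (1 - 1 / (2 * \<sigma>))"
    and "\<beta> = b * real m"
  shows "error_const m \<sigma> (\<lambda>N. phi_cosh m \<beta> (\<sigma> * real N))
    \<le> ereal (\<beta> * b_const m \<sigma> \<beta> / (2 * real m)
        * inverse (sqrt pi / (5 * sqrt (2 * real m)) * (1 - 1 / (2 * \<sigma>))
            * (1 - 1 / \<sigma>) powr (- 3 / 4) * exp (2 * pi * real m * sqrt (1 - 1 / \<sigma>))
            - 1 - gamma_const \<beta>))"
proof -
  define W where "W = 2 * pi * real m"
  define e where "e = 1 / (2 * \<sigma>)"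
  define a where "a = 1 - e"
  define c where "c = 1 - 1 / \<sigma>"
  define x0 where "x0 = W * sqrt c"
  define bracket where "bracket = sqrt pi / (5 * sqrt (2 * real m)) * a * c powr (- 3 / 4) * exp x0
      - 1 - gamma_const \<beta>"
  define B where "B = \<beta> * b_const m \<sigma> \<beta> / (2 * real m)"
  have beta: "\<beta> = W * a" using assms(3,4) by (simp add: W_def a_def e_def)
  have e_bounds: "0 \<le> e" "e \<le> 0.4" using assms(1) by (auto simp: e_def field_simps)
  have c_ge: "c \<ge> 0.2" using assms(1) by (simp add: c_def field_simps)
  have W_ge: "W \<ge> 12.56"
    using assms(2) pi_approx mult_mono[of "3.14" pi 2 "real m"] by (simp add: W_def)
  have beta_ge: "\<beta> \<ge> 7.5"
    using mult_mono[of "12.56" W "0.6" a] W_ge e_bounds unfolding beta by (simp add: a_def)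
  have "sqrt c \<ge> 0.447"
    using c_ge by (intro real_le_rsqrt) (simp add: power2_eq_square)
  then have x0_ge: "x0 \<ge> 5.6"
    using mult_mono[of "12.56" W "0.447" "sqrt c"] W_ge unfolding x0_def by simp
  define E where "E = exp x0 / (x0 * sqrt x0)"
  have E_ge: "E \<ge> 2.4" unfolding E_def by (rule exp_over_three_halves_ge[OF x0_ge])
  have betaE: "\<beta> * E \<ge> 18"
    using mult_mono[of "7.5" \<beta> "2.4" E] beta_ge E_ge by simp
  have bracket_eq: "bracket = pi / 5 * (\<beta> * E) - 1 - gamma_const \<beta>"
    unfolding bracket_def x0_def E_def beta
    using main_term_eq[of m c W a] assms(2) c_ge W_def by (simp add: mult.assoc)
  have gamma: "0 \<le> gamma_const \<beta>" "gamma_const \<beta> \<le> 1"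
    using gamma_const_bounds[of \<beta>] beta_ge by auto
  have "2 < pi / 5 * (\<beta> * E)"
    using mult_mono[of "0.6" "pi / 5" 18 "\<beta> * E"] pi_approx betaE by simp
  then have bracket_pos: "bracket > 0" unfolding bracket_eq using gamma by simp
  have bracket_le: "bracket \<le> cosh_transform \<beta> w" if "w\<^sup>2 + x0\<^sup>2 \<le> \<beta>\<^sup>2" for w
  proof -
    \<comment> \<open>The constant \<open>pi / 5\<close> of the bracket is less than \<open>1 / sqrt 2\<close> by more than \<open>1 / 18\<close>. As
      \<open>\<beta> * E \<ge> 18\<close>, this slack pays for replacing the correction \<open>- 2\<close> by \<open>- 1\<close>.\<close>
    have "0.7 \<le> 1 / sqrt 2"
    proof -
      have "sqrt 2 \<le> 10 / 7" by (rule real_le_lsqrt) (auto simp: power2_eq_square)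
      then show ?thesis by (simp add: field_simps)
    qed
    then have "(pi / 5 + 1 / 18) * (\<beta> * E) \<le> 1 / sqrt 2 * (\<beta> * E)"
      using pi_approx betaE by (intro mult_right_mono) auto
    then have "pi / 5 * (\<beta> * E) + 1 \<le> 1 / sqrt 2 * (\<beta> * E)"
      using betaE by (simp add: algebra_simps)
    then have "bracket \<le> 1 / sqrt 2 * (\<beta> * E) - 2" unfolding bracket_eq using gamma by simp
    also have "\<dots> = \<beta> * (exp x0 / (sqrt 2 * (x0 * sqrt x0))) - 2" by (simp add: E_def)
    also have "\<dots> \<le> cosh_transform \<beta> w"
      using that beta_ge x0_ge by (intro cosh_transform_ge) auto
    finally show ?thesis .
  qed
  have num: "pi * \<beta> + 4 / \<beta> + 64 * \<beta> / (W * sqrt W) \<le> B"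
    unfolding B_def using assms(1,2) W_def beta a_def e_def by (intro b_const_ge) auto
  have "0 \<le> pi * \<beta> + 4 / \<beta> + 64 * \<beta> / (W * sqrt W)"
    using beta_ge W_ge by (intro add_nonneg_nonneg) auto
  then have B_nonneg: "0 \<le> B" using num by (rule order_trans)
  have term_bound: "norm (\<Sum>\<^sub>\<infinity>r\<in>UNIV - {0::int}.
       fourier (phi_cosh m \<beta> (\<sigma> * real N)) (of_int n + of_int r * (\<sigma> * real N))
         / fourier (phi_cosh m \<beta> (\<sigma> * real N)) (of_int n)
         * exp (2 * of_real pi * \<i> * of_int r * of_real (\<sigma> * real N) * of_real x)) \<le> B * inverse bracket"
    if N: "N > 0" "even N" and n: "n \<in> index_set N" for N n x
  proof -
    define N1 where "N1 = \<sigma> * real N"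
    define \<nu> where "\<nu> = of_int n / N1"
    have N1: "N1 > 0" using N assms(1) by (simp add: N1_def)
    have "\<bar>real_of_int n\<bar> \<le> real N / 2"
      using n N by (auto simp: index_set_def abs_le_iff elim!: evenE)
    then have nu: "\<bar>\<nu>\<bar> \<le> e"
      using N N1 assms(1) by (simp add: \<nu>_def N1_def e_def abs_mult field_simps)
    have fou: "fourier (phi_cosh m \<beta> N1) (of_int n + of_int r * N1)
        = of_real (real m / N1 / (cosh \<beta> - 1) * cosh_transform \<beta> (W * (\<nu> + of_int r)))" for r
    proof -
      have "2 * pi * real m * (of_int n + of_int r * N1) / N1 = W * (\<nu> + of_int r)"
        using N1 by (simp add: W_def \<nu>_def field_simps)
      then show ?thesis using fourier_phi_cosh[of m N1] N1 assms(2) by simp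
    qed
    have K: "real m / N1 / (cosh \<beta> - 1) \<noteq> 0"
      using N1 assms(2) beta_ge by simp
    have fou0: "fourier (phi_cosh m \<beta> N1) (of_int n)
        = of_real (real m / N1 / (cosh \<beta> - 1) * cosh_transform \<beta> (W * \<nu>))"
      using fou[of 0] by simp
    have quotient: "fourier (phi_cosh m \<beta> N1) (of_int n + of_int r * N1) / fourier (phi_cosh m \<beta> N1) (of_int n)
        = of_real (cosh_transform \<beta> (W * (\<nu> + of_int r)) / cosh_transform \<beta> (W * \<nu>))" for r
      unfolding fou fou0 of_real_divide[symmetric] by (subst nonzero_mult_divide_mult_cancel_left[OF K]) (rule refl)
    have "(W * \<nu>)\<^sup>2 + x0\<^sup>2 \<le> \<beta>\<^sup>2"
    proof -
      have "\<nu>\<^sup>2 \<le> e\<^sup>2" using nu power_mono[of "\<bar>\<nu>\<bar>" e 2] by simp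
      \<comment> \<open>the reason for the exponent \<open>W * sqrt c\<close>: it is \<open>sqrt (\<beta>\<^sup>2 - w\<^sup>2)\<close> at the band edge \<open>w = W * e\<close>\<close>
      moreover have "c + e\<^sup>2 = a\<^sup>2"
        using assms(1) by (simp add: c_def a_def e_def power2_eq_square field_simps)
      ultimately have "W\<^sup>2 * (\<nu>\<^sup>2 + c) \<le> W\<^sup>2 * a\<^sup>2" by (intro mult_left_mono) auto
      then show ?thesis using c_ge by (simp add: x0_def beta power_mult_distrib distrib_left)
    qed
    then have D: "bracket \<le> cosh_transform \<beta> (W * \<nu>)" by (rule bracket_le)
    have "norm (\<Sum>\<^sub>\<infinity>r\<in>UNIV - {0::int}.
        fourier (phi_cosh m \<beta> N1) (of_int n + of_int r * N1) / fourier (phi_cosh m \<beta> N1) (of_int n)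
         * exp (2 * of_real pi * \<i> * of_int r * of_real N1 * of_real x))
       \<le> (pi * \<beta> + 4 / \<beta> + 64 * \<beta> / (W * sqrt W)) / cosh_transform \<beta> (W * \<nu>)"
    proof (rule aliasing_sum_le[of W e \<nu> \<beta>])
      fix r :: int
      have "norm (exp (2 * complex_of_real pi * \<i> * of_int r * of_real N1 * of_real x)) = 1"
        by (simp add: norm_exp_eq_Re)
      then show "norm (fourier (phi_cosh m \<beta> N1) (of_int n + of_int r * N1) / fourier (phi_cosh m \<beta> N1) (of_int n)
         * exp (2 * of_real pi * \<i> * of_int r * of_real N1 * of_real x))
         = \<bar>cosh_transform \<beta> (W * (\<nu> + of_int r))\<bar> / cosh_transform \<beta> (W * \<nu>)"
        using D bracket_pos unfolding quotient norm_mult norm_of_real by simp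
    qed (use W_ge e_bounds nu beta D bracket_pos in \<open>auto simp: a_def\<close>)
    also have "\<dots> \<le> B / bracket"
      by (rule frac_le[OF B_nonneg num bracket_pos D])
    finally show ?thesis unfolding N1_def by (simp add: divide_inverse)
  qed
  have "error_const m \<sigma> (\<lambda>N. phi_cosh m \<beta> (\<sigma> * real N)) \<le> ereal (B * inverse bracket)"
    unfolding error_const_def
  proof (rule SUP_least)
    fix N assume "N \<in> admissible m \<sigma>"
    then have N: "N > 0" "even N" by (auto simp: admissible_def)
    show "error_const_N \<sigma> N (phi_cosh m \<beta> (\<sigma> * real N)) \<le> ereal (B * inverse bracket)"
      unfolding error_const_N_def Let_def sup_norm_def
    proof (rule Max.boundedI)
      have "finite (index_set N)" "0 \<in> index_set N"
        using N by (auto simp: index_set_def elim!: evenE)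
      then show "finite (h ` index_set N)" "h ` index_set N \<noteq> {}" for h :: "int \<Rightarrow> ereal"
        by auto
    next
      fix u assume "u \<in> (\<lambda>n. SUP x. ereal (norm (\<Sum>\<^sub>\<infinity>r\<in>UNIV - {0::int}.
        fourier (phi_cosh m \<beta> (\<sigma> * real N)) (of_int n + of_int r * (\<sigma> * real N))
         / fourier (phi_cosh m \<beta> (\<sigma> * real N)) (of_int n)
         * exp (2 * of_real pi * \<i> * of_int r * of_real (\<sigma> * real N) * of_real x)))) ` index_set N"
      then show "u \<le> ereal (B * inverse bracket)"
        by (elim imageE, hypsubst, intro SUP_least) (simp only: ereal_less_eq term_bound[OF N])
    qed
  qed
  then show ?thesis unfolding B_def bracket_def a_def e_def c_def x0_def W_def .
qed

end
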